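(* Let $d\ge1$ and let $m>n\ge1$ be coprime integers. As maps on $\mathcal{Y}(dn,dm)$, $$\zeta=\mathcal{G}\circ\Psi_d.$$ Moreover, for $D\cong(y_{i,j})\in\mathcal{Y}(dn,dm)$ with $\Delta:=\Psi_d(D)\cong(c_{i,j})\in\mathcal{A}dm(dn,dm)$, and any $p=kn+\ell$ with $0\le k\le d-1$, $0\le\ell\le n-1$, we have $$\mathcal{G}((c_{i,j});(p,c_p))=\zeta\bigl((y_{i,j});(\mathbf{s}_\ell(k)n+\ell,\ y_{\mathbf{s}_\ell(k),\ell})\bigr).$$ In particular, $$e(\Delta)=|(c_{i,j})|=|D|,\qquad\dim\Delta=|\zeta(D)|=\mathrm{co}\text{-}\mathrm{dinv}(D).$$
   Context: Notation: $\mathbb{N}=\{0,1,\dots\}$. Indices run over $0\le i\le d-1$, $0\le j\le n-1$; a family indexed by $(i,j)$ is also indexed by $x=in+j$. $|(\cdot)|$ denotes the sum of all entries of a matrix or vector. $\mathrm{rk}(x,y)=mx-ny$. Admissible subsets. $\Gamma\subset\mathbb{N}$ is the semigroup (with $0$) generated by $dn,dm,dmn+1$; $\delta=|\mathbb{N}\setminus\Gamma|$; $\hat a_{i,j}=jdm+(dmn+1)i$; $a_{i,j}=mi+\lfloor jm/n\rfloor$. $\mathcal{A}dm(dn,dm)$ is the set of $\Delta\subset\mathbb{N}$ with $\min\Delta=0$, $\Gamma+\Delta\subset\Delta$, such that for every $0\le i\le d-1$ there is $a\in A(\Delta)$ with $a\equiv i\pmod d$ and $a+dm+1\in\Delta$,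 where $\Delta=\bigsqcup_{a\in A(\Delta)}(a+dn\mathbb{N})$. One writes uniquely $A(\Delta)=\{\hat a_{i,j}-dn\,c_{i,j}\}$, $0\le c_{i,j}\le a_{i,j}$, and identifies $\Delta$ with $(c_{i,j})$. $e(\Delta)=\delta-|\mathbb{N}\setminus\Delta|$; $\mathrm{Gaps}(a)=[a,\infty)\setminus\Delta$; $\dim\Delta=\sum_{a\in A(\Delta)}|\mathrm{Gaps}(a)|-\sum_{a\in A(\Delta)}|\mathrm{Gaps}(a+dm)|$. Dyck paths. $\mathcal{Y}(dn,dm)$ is the set of integer families $(y_x)_{0\le x\le dn-1}$ with $0\le y_x\le a_x$, $y_x\le y_{x+1}$; put $y_{dn}:=dm$. It is identified with $D=\{(x,y)\in\mathbb{Z}^2:0\le x\le dn-1,\ 1\le y\le y_x\}$ (boxes labelled by top-left vertex). For $z=(p,y)\in D$, $\mathfrak l(z)=y_p-y$ and $\mathfrak a(z)$ is the number of boxes of $D$ strictly to the left of $z$ in its row. $\mathrm{dinv}(D)=\#\{z\in D:\frac{\mathfrak l(z)}{\mathfrak a(z)+1}\le\frac mn<\frac{\mathfrak l(z)+1}{\mathfrak a(z)}\}$ (with $\frac{\mathfrak l+1}0=+\infty$), $\mathrm{co}\text{-}\mathrm{dinv}(D)=\delta-\mathrm{dinv}(D)$. The map $\Psi_d$. Set $\mathrm{rk}^{[0]}_x=mx-ny_x$. For $u=d-1,\dots,1$, given $(\mathrm{rk}^{[d-u-1]}_x)_{0\le x\le(u+1)n-1}$ put $\mathbf{p}_u=\max\{0\le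 x\le un:\mathrm{rk}^{[d-u-1]}_x\le\mathrm{rk}^{[d-u-1]}_{x+n-1}+m\}$, and for $0\le x\le un-1$ set $\mathrm{rk}^{[d-u]}_x=\mathrm{rk}^{[d-u-1]}_x$ if $x<\mathbf{p}_u$, $\mathrm{rk}^{[d-u]}_x=\mathrm{rk}^{[d-u-1]}_{x+n}$ if $x\ge\mathbf{p}_u$. Let $\mathbf{i}_{j,u}=\min\{0\le i\le u:in+j\ge\mathbf{p}_u\}$, let $\mathbf{s}_{j,u}$ be the cycle $(\mathbf{i}_{j,u}\ \cdots\ u)$ on $\{0,\dots,d-1\}$ ($i\mapsto i+1$ for $\mathbf{i}_{j,u}\le i<u$, $u\mapsto\mathbf{i}_{j,u}$), and $\mathbf{s}_j=\mathbf{s}_{j,d-1}\circ\cdots\circ\mathbf{s}_{j,1}$. Then $\Psi_d:\mathcal{Y}(dn,dm)\to\mathcal{A}dm(dn,dm)$, $(y_{i,j})\mapsto(c_{i,j})$, $c_{i,j}=y_{\mathbf{s}_j(i),j}-(\mathbf{s}_j(i)-i)m$. Sweep map $\zeta$. For $D\in\mathcal{Y}(dn,dm)$ and $(p,q)\in\mathbb{Z}^2$ with $0\le p\le dn-1$, $$\zeta(D;(p,q))=\#\{(x,y)\in\mathbb{Z}^2:0\le x\le dn-1,\ y_x<y\le y_{x+1},\ \mathrm{rk}(x,y)>\mathrm{rk}(p,q)\}+\#\{(x,y)\in\mathbb{Z}^2:p\le x\le dn-1,\ y_x<y\le y_{x+1},\ \mathrm{rk}(x,y)=\mathrm{rk}(p,q)\}.$$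 $\zeta(D)$ is the nondecreasing reordering of the $dn$ numbers $\zeta(D;(p,y_p))$, $0\le p\le dn-1$. The map $\mathcal{G}$. For $\Delta\cong(c_{i,j})\in\mathcal{A}dm(dn,dm)$ put $c_{i,n}:=c_{i,0}+m$ and $\hat{\mathrm{rk}}_\Delta(in+j,y)=d(m(in+j)-ny)+i$. For $(p,q)\in\mathbb{Z}^2$ with $0\le p\le dn-1$, $\mathcal{G}((c_{i,j});(p,q))=\mathcal{G}(\Delta;(p,q))$ is the number of $(x=in+j,y)\in\mathbb{Z}^2$ with $0\le x\le dn-1$, $c_{i,j}<y\le c_{i,j+1}$ and $\hat{\mathrm{rk}}_\Delta(x,y)>\hat{\mathrm{rk}}_\Delta(p,q)$. $\mathcal{G}(\Delta)$ is the nondecreasing reordering of the $dn$ numbers $\mathcal{G}(\Delta;(p,c_p))$, $0\le p\le dn-1$. *)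

theory Defs
  imports Complex_Main "HOL-Library.Disjoint_Sets"
begin

text \<open>A family indexed by \<open>0 \<le> i < d\<close>, \<open>0 \<le> j < n\<close> is an integer list of length \<open>d * n\<close> whose
  entry \<open>(i, j)\<close> sits at position \<open>x = i * n + j\<close>; thus \<open>i = x div n\<close> and \<open>j = x mod n\<close>, and the
  sum of all entries is \<^const>\<open>sum_list\<close>. Lattice points are pairs of a column \<open>x :: nat\<close> and a height
  \<open>y :: int\<close>, since every column that occurs is nonnegative.\<close>

context
  fixes d n m :: nat
begin

definition rk :: "nat \<Rightarrow> int \<Rightarrow> int" where
  "rk x y = int m * int x - int n * y"

definition a_hat :: "nat \<Rightarrow> nat" where
  "a_hat x = (x mod n) * d * m + (d * m * n + 1) * (x div n)"

definition a_bound :: "nat \<Rightarrow> nat" where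
  "a_bound x = m * (x div n) + ((x mod n) * m) div n"


subsection \<open>Admissible subsets\<close>

definition Gam :: "nat set" where
  "Gam = {\<alpha> * (d * n) + \<beta> * (d * m) + \<gamma> * (d * m * n + 1) | \<alpha> \<beta> \<gamma>. True}"

definition delta :: nat where
  "delta = card (UNIV - Gam)"

definition progression :: "nat \<Rightarrow> nat set" where
  "progression a = {a + d * n * k | k. True}"

definition is_base :: "nat set \<Rightarrow> nat set \<Rightarrow> bool" where
  "is_base A \<Delta> \<longleftrightarrow> \<Delta> = (\<Union>a\<in>A. progression a) \<and> disjoint_family_on progression A"

definition base :: "nat set \<Rightarrow> nat set" where
  "base \<Delta> = (THE A. is_base A \<Delta>)"

definition Adm :: "nat set set" where
  "Adm = {\<Delta>. 0 \<in> \<Delta> \<and> (\<forall>g\<in>Gam. \<forall>x\<in>\<Delta>. g + x \<in> \<Delta>) \<and>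
     (\<forall>i<d. \<exists>a\<in>base \<Delta>. a mod d = i \<and> a + d * m + 1 \<in> \<Delta>)}"

text \<open>The identification of \<open>\<Delta>\<close> with \<open>(c\<^sub>i\<^sub>j)\<close>.\<close>

definition corresponds :: "nat set \<Rightarrow> int list \<Rightarrow> bool" where
  "corresponds \<Delta> c \<longleftrightarrow> length c = d * n \<and>
     (\<forall>x<d * n. 0 \<le> c ! x \<and> c ! x \<le> int (a_bound x)) \<and>
     int ` base \<Delta> = {int (a_hat x) - int (d * n) * c ! x | x. x < d * n}"

definition coords :: "nat set \<Rightarrow> int list" where
  "coords \<Delta> = (THE c. corresponds \<Delta> c)"

definition subset_of :: "int list \<Rightarrow> nat set" where
  "subset_of c = {b. \<exists>x<d * n. \<exists>k::nat.
     int b = int (a_hat x) - int (d * n) * c ! x + int (d * n) * int k}"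

definition e_stat :: "nat set \<Rightarrow> int" where
  "e_stat \<Delta> = int delta - int (card (UNIV - \<Delta>))"

definition Gaps :: "nat set \<Rightarrow> nat \<Rightarrow> nat set" where
  "Gaps \<Delta> a = {a..} - \<Delta>"

definition dim_stat :: "nat set \<Rightarrow> int" where
  "dim_stat \<Delta> = (\<Sum>a\<in>base \<Delta>. int (card (Gaps \<Delta> a)))
     - (\<Sum>a\<in>base \<Delta>. int (card (Gaps \<Delta> (a + d * m))))"


subsection \<open>Dyck paths\<close>

text \<open>The convention \<open>y\<^bsub>dn\<^esub> = dm\<close>.\<close>

definition height :: "int list \<Rightarrow> nat \<Rightarrow> int" where
  "height y x = (if x = d * n then int (d * m) else y ! x)"

definition dyck_paths :: "int list set" where
  "dyck_paths = {y. length y = d * n \<and>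
     (\<forall>x<d * n. 0 \<le> y ! x \<and> y ! x \<le> int (a_bound x) \<and> height y x \<le> height y (x + 1))}"

definition boxes :: "int list \<Rightarrow> (nat \<times> int) set" where
  "boxes y = {(x, v). x < d * n \<and> 1 \<le> v \<and> v \<le> y ! x}"

definition leg :: "int list \<Rightarrow> nat \<times> int \<Rightarrow> int" where
  "leg y z = y ! fst z - snd z"

definition arm :: "int list \<Rightarrow> nat \<times> int \<Rightarrow> nat" where
  "arm y z = card {w \<in> boxes y. snd w = snd z \<and> fst w < fst z}"

definition dinv :: "int list \<Rightarrow> nat" where
  "dinv y = card {z \<in> boxes y.
     real_of_int (leg y z) / real (arm y z + 1) \<le> real m / real n \<and>
     (arm y z = 0 \<or> real m / real n < real_of_int (leg y z + 1) / real (arm y z))}"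

definition co_dinv :: "int list \<Rightarrow> int" where
  "co_dinv y = int delta - int (dinv y)"


subsection \<open>The map \<open>\<Psi>\<^sub>d\<close>\<close>

definition cut :: "nat \<Rightarrow> (nat \<Rightarrow> int) \<Rightarrow> nat" where
  "cut u r = Max {x. x \<le> u * n \<and> r x \<le> r (x + n - 1) + int m}"

text \<open>\<open>rk_seq y k\<close> is \<open>rk\<^bsup>[k]\<^esup>\<close>; the step from \<open>k\<close> to \<open>Suc k\<close> is the one with \<open>u = d - 1 - k\<close>.
  Only the values at \<open>x < (d - k) * n\<close> are meaningful.\<close>

primrec rk_seq :: "int list \<Rightarrow> nat \<Rightarrow> nat \<Rightarrow> int" where
  "rk_seq y 0 = (\<lambda>x. rk x (y ! x))"
| "rk_seq y (Suc k) =
     (\<lambda>x. if x < cut (d - 1 - k) (rk_seq y k) then rk_seq y k x else rk_seq y k (x + n))"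

definition p_cut :: "int list \<Rightarrow> nat \<Rightarrow> nat" where
  "p_cut y u = cut u (rk_seq y (d - u - 1))"

definition i_cut :: "int list \<Rightarrow> nat \<Rightarrow> nat \<Rightarrow> nat" where
  "i_cut y j u = Min {i. i \<le> u \<and> p_cut y u \<le> i * n + j}"

definition s_cycle :: "int list \<Rightarrow> nat \<Rightarrow> nat \<Rightarrow> nat \<Rightarrow> nat" where
  "s_cycle y j u i =
     (if i = u then i_cut y j u else if i_cut y j u \<le> i \<and> i < u then i + 1 else i)"

text \<open>\<open>s_comp y j k\<close> is \<open>s\<^sub>j\<^sub>,\<^sub>k \<circ> \<dots> \<circ> s\<^sub>j\<^sub>,\<^sub>1\<close>.\<close>

primrec s_comp :: "int list \<Rightarrow> nat \<Rightarrow> nat \<Rightarrow> nat \<Rightarrow> nat" where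
  "s_comp y j 0 = id"
| "s_comp y j (Suc k) = s_cycle y j (Suc k) \<circ> s_comp y j k"

definition s_perm :: "int list \<Rightarrow> nat \<Rightarrow> nat \<Rightarrow> nat" where
  "s_perm y j = s_comp y j (d - 1)"

definition Psi_coords :: "int list \<Rightarrow> int list" where
  "Psi_coords y = map (\<lambda>x. let i = x div n; j = x mod n; i' = s_perm y j i in
      y ! (i' * n + j) - (int i' - int i) * int m) [0..<d * n]"

definition Psi :: "int list \<Rightarrow> nat set" where
  "Psi y = subset_of (Psi_coords y)"


subsection \<open>The sweep map and the map \<open>\<G>\<close>\<close>

definition zeta_at :: "int list \<Rightarrow> nat \<times> int \<Rightarrow> nat" where
  "zeta_at y = (\<lambda>(p, q).
     card {(x, v). x < d * n \<and> height y x < v \<and> v \<le> height y (x + 1) \<and> rk x v > rk p q}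
   + card {(x, v). p \<le> x \<and> x < d * n \<and> height y x < v \<and> v \<le> height y (x + 1) \<and> rk x v = rk p q})"

definition zeta :: "int list \<Rightarrow> int list" where
  "zeta y = sort (map (\<lambda>p. int (zeta_at y (p, y ! p))) [0..<d * n])"

text \<open>The convention \<open>c\<^sub>i\<^sub>,\<^sub>n = c\<^sub>i\<^sub>,\<^sub>0 + m\<close>; in particular \<open>c_ext c i n\<close> is not \<open>c_ext c (i + 1) 0\<close>.\<close>

definition c_ext :: "int list \<Rightarrow> nat \<Rightarrow> nat \<Rightarrow> int" where
  "c_ext c i j = (if j = n then c ! (i * n) + int m else c ! (i * n + j))"

definition rk_hat :: "nat \<Rightarrow> int \<Rightarrow> int" where
  "rk_hat x y = int d * (int m * int x - int n * y) + int (x div n)"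

definition G_at :: "int list \<Rightarrow> nat \<times> int \<Rightarrow> nat" where
  "G_at c = (\<lambda>(p, q).
     card {(x, v). x < d * n \<and> c_ext c (x div n) (x mod n) < v \<and>
                   v \<le> c_ext c (x div n) (x mod n + 1) \<and> rk_hat x v > rk_hat p q})"

definition G_map :: "nat set \<Rightarrow> int list" where
  "G_map \<Delta> = (let c = coords \<Delta> in sort (map (\<lambda>p. int (G_at c (p, c ! p))) [0..<d * n]))"

end


subsection \<open>The descriptions used above are unambiguous\<close>

lemma is_base_iff:
  assumes "d * n > 0"
  shows "is_base d n A \<Delta> \<longleftrightarrow>
    (\<forall>x\<in>\<Delta>. x + d * n \<in> \<Delta>) \<and> A = {a \<in> \<Delta>. \<not> (\<exists>b\<in>\<Delta>. a = b + d * n)}"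
proof -
  define N where "N = d * n"
  have N: "N > 0" using assms by (simp add: N_def)
  have P: "progression d n a = {a + N * k | k. True}" for a
    by (simp add: progression_def N_def)
  have shift: "b + N \<in> progression d n a" if "b \<in> progression d n a" for a b
  proof -
    from that obtain k where "b = a + N * k" by (auto simp: P)
    then have "b + N = a + N * Suc k" by simp
    then show ?thesis unfolding P by blast
  qed
  have self: "a \<in> progression d n a" for a unfolding P by (auto intro: exI[of _ 0])
  have cancel: "x \<in> progression d n b \<or> b \<in> progression d n x"
    if "x + N * k = b + N * l" for x b k l
  proof (cases "k \<le> l")
    case True
    then obtain t where "l = k + t" using le_Suc_ex by blast
    with that have "x = b + N * t" by (simp add: algebra_simps)
    then show ?thesis by (auto simp: P)
  next
    case False
    then obtain t where "k = l + t" using le_Suc_ex nat_le_linear by blast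
    with that have "b = x + N * t" by (simp add: algebra_simps)
    then show ?thesis by (auto simp: P)
  qed
  show ?thesis unfolding N_def[symmetric]
  proof
    assume "is_base d n A \<Delta>"
    then have U: "\<Delta> = (\<Union>a\<in>A. progression d n a)"
      and D: "disjoint_family_on (progression d n) A" by (auto simp: is_base_def)
    have "x + N \<in> \<Delta>" if "x \<in> \<Delta>" for x
      using that shift unfolding U by blast
    moreover have "a \<in> A \<longleftrightarrow> a \<in> \<Delta> \<and> \<not> (\<exists>b\<in>\<Delta>. a = b + N)" for a
    proof
      assume a: "a \<in> A"
      have "a \<noteq> b + N" if b: "b \<in> \<Delta>" for b
      proof
        assume eq: "a = b + N"
        from b obtain a' where a': "a' \<in> A" "b \<in> progression d n a'" unfolding U by blast
        have "a \<in> progression d n a'" using shift[OF a'(2)] eq by simp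
        with self[of a] a a'(1) D have "a = a'" unfolding disjoint_family_on_def by blast
        with a'(2) eq N show False by (auto simp: P)
      qed
      then show "a \<in> \<Delta> \<and> \<not> (\<exists>b\<in>\<Delta>. a = b + N)" using a self unfolding U by blast
    next
      assume a: "a \<in> \<Delta> \<and> \<not> (\<exists>b\<in>\<Delta>. a = b + N)"
      then obtain a' k where a': "a' \<in> A" "a = a' + N * k" unfolding U by (auto simp: P)
      show "a \<in> A"
      proof (cases k)
        case 0 then show ?thesis using a' by simp
      next
        case (Suc k')
        have "a' + N * k' \<in> \<Delta>" using a'(1) unfolding U by (auto simp: P)
        moreover have "a = (a' + N * k') + N" using a'(2) Suc by simp
        ultimately show ?thesis using a by blast
      qed
    qed
    ultimately show "(\<forall>x\<in>\<Delta>. x + N \<in> \<Delta>) \<and> A = {a \<in> \<Delta>. \<not> (\<exists>b\<in>\<Delta>. a = b + N)}" by blast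
  next
    assume asm: "(\<forall>x\<in>\<Delta>. x + N \<in> \<Delta>) \<and> A = {a \<in> \<Delta>. \<not> (\<exists>b\<in>\<Delta>. a = b + N)}"
    then have A: "A = {a \<in> \<Delta>. \<not> (\<exists>b\<in>\<Delta>. a = b + N)}" by blast
    have add: "x + N * k \<in> \<Delta>" if "x \<in> \<Delta>" for x k
    proof (induction k)
      case (Suc k)
      have "x + N * Suc k = (x + N * k) + N" by simp
      then show ?case using Suc asm by metis
    qed (use that in simp)
    have ex: "\<exists>a\<in>A. x \<in> progression d n a" if "x \<in> \<Delta>" for x
      using that
    proof (induction x rule: less_induct)
      case (less x)
      show ?case
      proof (cases "\<exists>b\<in>\<Delta>. x = b + N")
        case True
        then obtain b where "b \<in> \<Delta>" "x = b + N" by blast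
        with less.IH[of b] N shift show ?thesis by (metis less_add_same_cancel1)
      next
        case False
        then show ?thesis using less.prems self unfolding A by blast
      qed
    qed
    have "\<Delta> = (\<Union>a\<in>A. progression d n a)"
      using ex add by (auto simp: P A)
    moreover have eq: "a = b" if "a \<in> A" "b \<in> A" "a \<in> progression d n b" for a b
    proof -
      from that(3) obtain k where k: "a = b + N * k" by (auto simp: P)
      show ?thesis
      proof (cases k)
        case 0 then show ?thesis using k by simp
      next
        case (Suc k')
        then have "a = (b + N * k') + N" using k by simp
        moreover have "b + N * k' \<in> \<Delta>" using add that(2) A by blast
        ultimately show ?thesis using that(1) A by blast
      qed
    qed
    have "disjoint_family_on (progression d n) A"
      unfolding disjoint_family_on_def
    proof (intro ballI impI)
      fix a b assume ab: "a \<in> A" "b \<in> A" "a \<noteq> b"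
      show "progression d n a \<inter> progression d n b = {}"
      proof (rule ccontr)
        assume "progression d n a \<inter> progression d n b \<noteq> {}"
        then obtain k l where "a + N * k = b + N * l" by (auto simp: P)
        with cancel eq ab show False by metis
      qed
    qed
    ultimately show "is_base d n A \<Delta>" by (simp add: is_base_def)
  qed
qed

lemma base_eq:
  assumes "d * n > 0" "\<And>x. x \<in> \<Delta> \<Longrightarrow> x + d * n \<in> \<Delta>"
  shows "base d n \<Delta> = {a \<in> \<Delta>. \<not> (\<exists>b\<in>\<Delta>. a = b + d * n)}"
  unfolding base_def using assms by (intro the_equality) (auto simp: is_base_iff)

lemma a_hat_inj_mod:
  assumes "d \<ge> 1" "n \<ge> 1" "coprime m n" "x < d * n" "x' < d * n"
    "a_hat d n m x mod (d * n) = a_hat d n m x' mod (d * n)"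
  shows "x = x'"
proof -
  have lt: "x div n < d" "x' div n < d"
    using assms by (simp_all add: less_mult_imp_div_less)
  have md: "a_hat d n m z mod d = (z div n) mod d" for z
  proof -
    have "a_hat d n m z = z div n + d * ((z mod n) * m + m * n * (z div n))"
      by (simp add: a_hat_def algebra_simps)
    then show ?thesis by (metis mod_mult_self2)
  qed
  have "a_hat d n m x mod d = a_hat d n m x' mod d"
    by (metis assms(6) mod_mod_cancel dvd_triv_left)
  with md lt have q: "x div n = x' div n" by simp
  have hs: "a_hat d n m z = d * ((z mod n) * m) + (d * m * n + 1) * (z div n)" for z
    by (simp add: a_hat_def algebra_simps)
  have "int (d * ((x mod n) * m)) mod int (d * n) = int (d * ((x' mod n) * m)) mod int (d * n)"
  proof -
    have "int (a_hat d n m x) mod int (d * n) = int (a_hat d n m x') mod int (d * n)"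
      using assms(6) by (metis of_nat_mod)
    then have "int (d * n) dvd int (a_hat d n m x) - int (a_hat d n m x')"
      by (simp only: mod_eq_dvd_iff)
    moreover have "int (a_hat d n m x) - int (a_hat d n m x') =
        int (d * ((x mod n) * m)) - int (d * ((x' mod n) * m))"
      by (simp only: hs q of_nat_add)
    ultimately show ?thesis by (simp only: mod_eq_dvd_iff)
  qed
  then have "(d * ((x mod n) * m)) mod (d * n) = (d * ((x' mod n) * m)) mod (d * n)"
    by (metis of_nat_mod of_nat_eq_iff)
  then have "((x mod n) * m) mod n = ((x' mod n) * m) mod n"
    using assms(1) by (simp flip: mult_mod_right)
  then have "int n dvd int (x mod n) * int m - int (x' mod n) * int m"
    by (metis mod_eq_dvd_iff of_nat_mod of_nat_mult)
  then have "int n dvd (int (x mod n) - int (x' mod n)) * int m"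
    by (simp add: algebra_simps)
  then have "int n dvd int (x mod n) - int (x' mod n)"
    using assms(3) by (metis coprime_commute coprime_dvd_mult_left_iff coprime_int_iff)
  then have "int (x mod n) mod int n = int (x' mod n) mod int n"
    by (simp only: mod_eq_dvd_iff)
  then have "x mod n = x' mod n"
    by (metis mod_mod_trivial of_nat_eq_iff of_nat_mod)
  with q show ?thesis by (metis div_mod_decomp)
qed

lemma corresponds_unique:
  assumes "d \<ge> 1" "n \<ge> 1" "coprime m n"
    and c: "corresponds d n m \<Delta> c" and c': "corresponds d n m \<Delta> c'"
  shows "c = c'"
proof (rule nth_equalityI)
  show "length c = length c'" using c c' by (simp add: corresponds_def)
  fix x assume "x < length c"
  then have x: "x < d * n" using c by (simp add: corresponds_def)
  have "{int (a_hat d n m x) - int (d * n) * c ! x | x. x < d * n}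
      = {int (a_hat d n m x) - int (d * n) * c' ! x | x. x < d * n}"
    using c c' by (simp add: corresponds_def)
  then obtain z where z: "z < d * n"
    "int (a_hat d n m x) - int (d * n) * c ! x = int (a_hat d n m z) - int (d * n) * c' ! z"
    using x by blast
  have "int (a_hat d n m x) - int (a_hat d n m z) = int (d * n) * (c ! x - c' ! z)"
    using z(2) by (simp add: right_diff_distrib del: of_nat_mult)
  then have "int (a_hat d n m x) mod int (d * n) = int (a_hat d n m z) mod int (d * n)"
    by (metis mod_eq_dvd_iff dvd_triv_left)
  then have "a_hat d n m x mod (d * n) = a_hat d n m z mod (d * n)"
    by (metis of_nat_mod of_nat_eq_iff)
  with a_hat_inj_mod assms x z(1) have "x = z" by metis
  with z(2) assms show "c ! x = c' ! x" by auto
qed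

lemma coords_eq:
  assumes "d \<ge> 1" "n \<ge> 1" "coprime m n" "corresponds d n m \<Delta> c"
  shows "coords d n m \<Delta> = c"
  unfolding coords_def using assms corresponds_unique by (intro the_equality) blast+

lemma card_boxes:
  assumes "y \<in> dyck_paths d n m"
  shows "int (card (boxes d n y)) = sum_list y"
proof -
  have len: "length y = d * n" and pos: "\<And>x. x < d * n \<Longrightarrow> 0 \<le> y ! x"
    using assms by (auto simp: dyck_paths_def)
  have "boxes d n y = (SIGMA x:{..<d * n}. {1..y ! x})"
    by (auto simp: boxes_def)
  then have "int (card (boxes d n y)) = (\<Sum>x<d * n. y ! x)"
    using pos by simp
  also have "\<dots> = sum_list y"
    by (simp add: sum_list_sum_nth len atLeast0LessThan)
  finally show ?thesis .
qed

end

theory Submission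
  imports Defs "HOL-Library.Multiset"
begin

text \<open>Write \<open>r x = m x - n y\<^sub>x\<close> for the rank of column \<open>x\<close> of a Dyck
path, with \<open>r (dn) = 0\<close>. One step of \<open>\<Psi>\<^sub>d\<close> removes from the
sequence of ranks a segment of \<open>n\<close> consecutive columns that starts at the cut
\<open>p\<close>. The choice of \<open>p\<close> makes the removed segment close up cyclically
(its last rank plus \<open>m\<close> is at least its first rank), and the maximality of
\<open>p\<close> makes the rest a rank walk again (\<open>removal_walk\<close>), because behind
the cut the ranks strictly decrease along each residue class modulo \<open>n\<close>
(\<open>drop\<close>). Sorted by residue, the segment removed at step \<open>u\<close> is row
\<open>u\<close> of \<open>\<Delta>\<close>. So the ranks of all rows are a rearrangement of the
ranks \<open>r x\<close>, and the base of \<open>\<Delta>\<close> consists of the numbers \<open>d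
* row_rank x + x div n\<close>.

The vertical steps in one column have ranks in an arithmetic progression of difference
\<open>n\<close>. The number of those of rank at least \<open>t\<close> is therefore a difference
of two values of one function, taken at \<open>r x\<close> and at \<open>r (x + 1) - m\<close>.
Summed over a closed chain of columns, such counts depend only on the multiset of ranks; hence the
steps of rank strictly above a threshold are equally numerous for \<open>D\<close> and for
\<open>\<Delta>\<close>. It remains to compare the ties: the steps of \<open>D\<close> of rank
\<open>r z\<close> from column \<open>z\<close> on, and the steps of that rank in the rows of
\<open>\<Delta>\<close> with a larger index than the row of \<open>z\<close>. This is an induction
over the cuts (\<open>ties_by_row\<close>). If \<open>z\<close> lies in the removed segment, no
tie follows it; if \<open>z\<close> lies before the segment, the whole segment follows it; if
\<open>z\<close> lies behind the segment, the segment contributes zero.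

That \<open>\<Delta>\<close> is admissible rests on two facts: each row climbs by at most
\<open>m\<close> cyclically (\<open>row_climb\<close>), and the rank at a cut exceeds some entry
of the preceding row, one residue class back, by at most \<open>m\<close>
(\<open>row_link\<close>). Counting the missing numbers in each residue class modulo
\<open>dn\<close> gives \<open>\<delta>\<close>, \<open>e \<Delta>\<close> and the sizes of the
gap sets; the difference of the gap counts at \<open>a\<close> and \<open>a + dm\<close> is the
telescoped form of \<open>\<G>\<close>, so \<open>dim \<Delta>\<close> is the sum of the entries
of \<open>\<G> \<Delta>\<close>.

For the last equation, a box in column \<open>p\<close> sees exactly one vertical step of its row
to its left, say in column \<open>w\<close>, and the two inequalities that define dinv say that
the rank of this step lies in the interval from \<open>r p - m - n\<close> (exclusive) to \<open>r
p\<close> (inclusive). Added to \<open>\<zeta>\<close>, the counts telescope once more, into a sum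
over pairs \<open>w < p\<close> in which the contribution of a pair is \<open>\<lfloor>m (p - w) /
n\<rfloor> - \<lfloor>m (p - w - 1) / n\<rfloor>\<close>, whatever the path is
(\<open>pair_contribution\<close>). The total is the sum of all \<open>\<lfloor>m p /
n\<rfloor>\<close>, which is \<open>\<delta>\<close>.\<close>

section \<open>Residues and counts in arithmetic progressions\<close>

lemma window_inj:
  fixes a b p n :: nat
  assumes "p \<le> a" "a < p + n" "p \<le> b" "b < p + n" "a mod n = b mod n"
  shows "a = b"
proof -
  have le: "a \<le> b" if "p \<le> b" "a < p + n" "a mod n = b mod n" for a b
  proof (rule ccontr)
    assume "\<not> a \<le> b"
    then have "n dvd a - b" using that(3) by (metis mod_eq_dvd_iff_nat nat_le_linear)
    then have "n \<le> a - b" using \<open>\<not> a \<le> b\<close> by (intro dvd_imp_le) auto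
    then show False using that \<open>\<not> a \<le> b\<close> by linarith
  qed
  show ?thesis using le[of b a] le[of a b] assms by simp
qed

lemma window_bij: "bij_betw (\<lambda>x. x mod n) {p..<p + n} {..<n}" for n p :: nat
proof (rule bij_betw_imageI)
  show inj: "inj_on (\<lambda>x. x mod n) {p..<p + n}"
    by (rule inj_onI) (use window_inj in auto)
  show "(\<lambda>x. x mod n) ` {p..<p + n} = {..<n}"
    by (rule card_subset_eq) (auto simp: card_image[OF inj])
qed

lemma sum_window_residue:
  fixes n p c :: nat
  assumes "n \<ge> 1"
  shows "(\<Sum>x = p..<p + n. if x mod n = c mod n then 1 else 0 :: int) = 1"
proof -
  have "(\<Sum>x = p..<p + n. if x mod n = c mod n then 1 else 0 :: int)
      = (\<Sum>j<n. if j = c mod n then 1 else 0)"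
    by (rule sum.reindex_bij_betw[OF window_bij, of "\<lambda>j. if j = c mod n then 1 else 0"])
  then show ?thesis using assms by simp
qed

lemma int_dvd_iff_mod: "int n dvd int x - int z \<longleftrightarrow> x mod n = z mod n"
  by (metis mod_eq_dvd_iff of_nat_eq_iff of_nat_mod)

lemma residue_solution:
  fixes m n :: nat and a :: int
  assumes "n \<ge> 1" "coprime m n"
  shows "\<exists>j<n. int n dvd int m * int j - a"
proof -
  obtain u v where uv: "u * int m + v * int n = 1"
    using assms(2) bezout_int[of "int m" "int n"] by (metis coprime_imp_gcd_eq_1 coprime_int_iff)
  define j where "j = nat ((u * a) mod int n)"
  have j: "int j = (u * a) mod int n" using assms(1) by (simp add: j_def)
  have "int m * int j - a = int m * (u * a - int n * ((u * a) div int n)) - a"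
    unfolding j by (simp add: minus_mult_div_eq_mod)
  also have "\<dots> = a * (u * int m + v * int n) - a - int n * (int m * ((u * a) div int n) + a * v)"
    by (simp add: algebra_simps)
  also have "\<dots> = int n * - (int m * ((u * a) div int n) + a * v)" unfolding uv by (simp add: algebra_simps)
  finally have "int n dvd int m * int j - a" by (simp only: dvd_triv_left)
  moreover have "j < n" using assms(1) by (simp add: j_def nat_less_iff)
  ultimately show ?thesis by blast
qed

text \<open>The indicator that \<open>t\<close> is one of the values \<open>a - n k\<close> with \<open>k
\<ge> 1\<close>.\<close>

definition tie :: "nat \<Rightarrow> int \<Rightarrow> int \<Rightarrow> int" where
  "tie n t a = (if t < a \<and> int n dvd a - t then 1 else 0)"

text \<open>What a column of rank \<open>a\<close> contributes to the number of vertical steps of rank exactly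
\<open>t\<close>: the ranks of its own run of steps begin below \<open>a\<close>, and those of the
run in the column before it end at \<open>a - m\<close>.\<close>

definition tie_change :: "nat \<Rightarrow> nat \<Rightarrow> int \<Rightarrow> int \<Rightarrow> int" where
  "tie_change n m t a = tie n t a - tie n t (a - int m)"

text \<open>The number of \<open>k \<ge> 1\<close> with \<open>a - N k \<ge> t\<close>. All counts below are
sums and differences of such numbers.\<close>

definition reach :: "nat \<Rightarrow> int \<Rightarrow> int \<Rightarrow> int" where
  "reach N t a = max 0 ((a - t) div int N)"

lemma div_shift:
  assumes "N \<ge> 1"
  shows "(a - int N * k) div int N = a div int N - k"
proof -
  have "a - int N * k = a + int N * (- k)" by simp
  then have "(a - int N * k) div int N = (a + int N * (- k)) div int N" by (simp only:)
  also have "\<dots> = - k + a div int N" using assms by (intro div_mult_self2) simp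
  finally show ?thesis by simp
qed

lemma le_div_iff_mult_le_int: "N \<ge> 1 \<Longrightarrow> v \<le> a div int N \<longleftrightarrow> int N * v \<le> a"
proof -
  assume N: "N \<ge> 1"
  have "(a - int N * v) div int N = a div int N - v"
    by (rule div_shift[OF N])
  moreover have "0 \<le> (a - int N * v) div int N \<longleftrightarrow> 0 \<le> a - int N * v"
    using N by (intro pos_imp_zdiv_nonneg_iff) simp
  ultimately show ?thesis by auto
qed

lemma column_set:
  assumes "N \<ge> 1"
  shows "{v. A < v \<and> v \<le> B \<and> t \<le> e - int N * v} = {A<..min B ((e - t) div int N)}"
proof -
  have *: "t \<le> e - int N * v \<longleftrightarrow> v \<le> (e - t) div int N" for v
    unfolding le_div_iff_mult_le_int[OF assms] by linarith
  show ?thesis unfolding * by auto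
qed

lemma finite_column: "finite {v :: int. A < v \<and> v \<le> B \<and> Q v}"
  by (rule finite_subset[of _ "{A..B}"]) auto

text \<open>The heights \<open>v\<close> in \<open>(A, B]\<close> are the steps of one column, and \<open>e -
N v\<close> are their ranks: those with \<open>v > B\<close> are subtracted from those with
\<open>v > A\<close>.\<close>

lemma column_card:
  assumes "N \<ge> 1" "A \<le> B"
  shows "int (card {v. A < v \<and> v \<le> B \<and> t \<le> e - int N * v})
    = reach N t (e - int N * A) - reach N t (e - int N * B)"
proof -
  define q where "q = (e - t) div int N"
  have "reach N t (e - int N * k) = max 0 (q - k)" for k
  proof -
    have "e - int N * k - t = (e - t) - int N * k" by simp
    then show ?thesis unfolding reach_def q_def by (simp only: div_shift[OF assms(1)])
  qed
  moreover have "int (card {v. A < v \<and> v \<le> B \<and> t \<le> e - int N * v}) = max 0 (min B q - A)"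
    unfolding column_set[OF assms(1)] q_def[symmetric] by (simp add: max_def)
  ultimately show ?thesis using assms(2) by (simp add: max_def min_def)
qed

lemma tie_eq_reach:
  assumes "n \<ge> 1"
  shows "tie n t a = reach n t a - reach n (t + 1) a"
proof -
  let ?z = "a - t" and ?q = "(a - t) div int n"
  have n: "int n > 0" using assms by simp
  have z: "?z = int n * ?q + ?z mod int n" by simp
  have e: "a - (t + 1) = ?z - 1" by simp
  show ?thesis
  proof (cases "int n dvd ?z")
    case True
    then obtain q where q: "?z = int n * q" by (elim dvdE)
    then have 1: "?q = q" using n by simp
    have "?z - 1 = - 1 - int n * (- q)" using q by simp
    then have "(?z - 1) div int n = (- 1) div int n + q"
      by (simp only: div_shift[OF assms] diff_minus_eq_add)
    also have "(- 1) div int n = -1" using n by (simp add: div_eq_minus1)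
    finally have 2: "(?z - 1) div int n = q - 1" by simp
    have "t < a \<longleftrightarrow> 0 < int n * q" using q by linarith
    also have "\<dots> \<longleftrightarrow> 0 < q" using n by (simp add: zero_less_mult_iff)
    finally have 3: "t < a \<longleftrightarrow> 0 < q" .
    show ?thesis unfolding tie_def reach_def e 1 2 3 using True by auto
  next
    case False
    then have pos: "0 < ?z mod int n" using n by (metis dvd_eq_mod_eq_0 less_le pos_mod_sign)
    have "(?z - 1) div int n = ?q"
    proof (rule int_div_pos_eq)
      show "?z - 1 = int n * ?q + (?z mod int n - 1)" using z by linarith
      show "0 \<le> ?z mod int n - 1" using pos by linarith
      show "?z mod int n - 1 < int n" using pos_mod_bound[OF n, of ?z] by linarith
    qed
    then show ?thesis using False by (simp add: tie_def reach_def e)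
  qed
qed

lemma div_add_digit:
  fixes d n i :: nat and a :: int
  assumes "i < d"
  shows "(int d * a + int i) div int (d * n) = a div int n"
proof -
  have "(int d * a + int i) div int (d * n) = ((int d * a + int i) div int d) div int n"
    by (simp add: zdiv_zmult2_eq)
  also have "(int d * a + int i) div int d = a"
    using assms by (intro int_div_pos_eq[of _ _ _ "int i"]) auto
  finally show ?thesis .
qed

text \<open>Comparing \<open>d a + i\<close> with \<open>d t + k\<close> for digits \<open>i, k < d\<close> is
a lexicographic comparison. This is how the rank function of \<open>\<Delta>\<close> breaks ties
by the row index.\<close>

lemma reach_lex:
  fixes d n i k :: nat and a t :: int
  assumes "i < d" "k < d"
  shows "reach (d * n) (int d * t + int k + 1) (int d * a + int i)
    = reach n (t + (if k < i then 0 else 1)) a"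
proof (cases "k < i")
  case True
  then have "int d * a + int i - (int d * t + int k + 1) = int d * (a - t) + int (i - Suc k)"
    by (simp add: algebra_simps of_nat_diff)
  moreover have "i - Suc k < d" using assms by simp
  ultimately show ?thesis using True by (simp only: reach_def div_add_digit if_True add_0_right)
next
  case False
  then have "int d * a + int i - (int d * t + int k + 1)
      = int d * (a - (t + 1)) + int (d + i - Suc k)"
    using assms by (simp add: algebra_simps of_nat_diff)
  moreover have "d + i - Suc k < d" using False assms by simp
  ultimately show ?thesis using False by (simp only: reach_def div_add_digit if_False)
qed

lemma card_columns:
  fixes Q :: "nat \<Rightarrow> int \<Rightarrow> bool"
  assumes "\<And>x. x \<in> X \<Longrightarrow> finite {v. Q x v}" "finite X"
  shows "int (card {(x, v). x \<in> X \<and> Q x v}) = (\<Sum>x\<in>X. int (card {v. Q x v}))"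
proof -
  have "{(x, v). x \<in> X \<and> Q x v} = (SIGMA x:X. {v. Q x v})" by auto
  then show ?thesis using assms by simp
qed

lemma neg_div_round_up:
  assumes "n \<ge> 1"
  shows "(int n - 1 - z) div int n = - (z div int n)"
proof (rule int_div_pos_eq)
  have n: "0 < int n" using assms by simp
  show "int n - 1 - z = int n * - (z div int n) + (int n - 1 - z mod int n)"
    using mult_div_mod_eq[of "int n" z] by linarith
  show "0 \<le> int n - 1 - z mod int n" using pos_mod_bound[OF n, of z] by linarith
  show "int n - 1 - z mod int n < int n" using pos_mod_sign[OF n, of z] by linarith
qed

text \<open>The difference of the positive and the negative part of \<open>\<lceil>z / n\<rceil>\<close> for
\<open>z = a - b\<close>; the negative part arises as the positive part of \<open>\<lfloor>- z /
n\<rfloor>\<close>.\<close>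

lemma reach_balance:
  assumes "n \<ge> 1"
  shows "reach n (b + 1 - int n) a - reach n a b = (a - b + int n - 1) div int n"
proof -
  have "a - (b + 1 - int n) = int n - 1 - (b - a)" "a - b + int n - 1 = int n - 1 - (b - a)" by simp_all
  then show ?thesis unfolding reach_def by (simp only: neg_div_round_up[OF assms])
qed

lemma sum_triangle:
  fixes g :: "nat \<Rightarrow> nat \<Rightarrow> int"
  shows "(\<Sum>p<N. \<Sum>w = Suc p..<N. g p w) = (\<Sum>p<N. \<Sum>w<p. g w p)"
proof -
  have 1: "(\<Sum>w = Suc p..<N. g p w) = (\<Sum>w<N. if p < w then g p w else 0)" for p
    by (rule sum.mono_neutral_cong_left) auto
  have 2: "(\<Sum>w<p. g w p) = (\<Sum>w<N. if w < p then g w p else 0)" if "p < N" for p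
    using that by (intro sum.mono_neutral_cong_left) auto
  have "(\<Sum>p<N. \<Sum>w = Suc p..<N. g p w) = (\<Sum>p<N. \<Sum>w<N. if p < w then g p w else 0)"
    by (simp only: 1)
  also have "\<dots> = (\<Sum>p<N. \<Sum>w<N. if w < p then g w p else 0)" by (rule sum.swap)
  also have "\<dots> = (\<Sum>p<N. \<Sum>w<p. g w p)" by (rule sum.cong[OF refl]) (simp add: 2)
  finally show ?thesis .
qed

section \<open>Cutting a segment out of a rank walk\<close>

text \<open>The ranks of a Dyck path with \<open>L\<close> columns, but without the path: the heights are
recovered from the condition modulo \<open>n\<close>, the last condition says that they do not
decrease, and nonnegativity says that the path stays below the diagonal.\<close>

definition rank_walk :: "nat \<Rightarrow> nat \<Rightarrow> nat \<Rightarrow> (nat \<Rightarrow> int) \<Rightarrow> bool" where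
  "rank_walk n m L r \<longleftrightarrow> r 0 = 0
     \<and> (\<forall>x<L. 0 \<le> r x \<and> int n dvd r x - int m * int x)
     \<and> (\<forall>x. Suc x < L \<longrightarrow> r (Suc x) \<le> r x + int m)"

locale cut_walk =
  fixes n m u :: nat and r :: "nat \<Rightarrow> int"
  assumes n_pos: "n \<ge> 1"
    and walk: "rank_walk n m (Suc u * n) r"
begin

abbreviation p :: nat where "p \<equiv> cut n m u r"

lemma start: "r 0 = 0"
  using walk by (simp add: rank_walk_def)

lemma nonneg: "x < Suc u * n \<Longrightarrow> 0 \<le> r x"
  using walk by (simp add: rank_walk_def)

lemma residue: "x < Suc u * n \<Longrightarrow> int n dvd r x - int m * int x"
  using walk by (simp add: rank_walk_def)

lemma climb: "Suc x < Suc u * n \<Longrightarrow> r (Suc x) \<le> r x + int m"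
  using walk by (simp add: rank_walk_def)

lemma cut_set:
  shows "finite {x. x \<le> u * n \<and> r x \<le> r (x + n - 1) + int m}"
    and "0 \<in> {x. x \<le> u * n \<and> r x \<le> r (x + n - 1) + int m}"
proof -
  show "finite {x. x \<le> u * n \<and> r x \<le> r (x + n - 1) + int m}" by simp
  have "0 \<le> r (n - 1)" using n_pos by (intro nonneg) auto
  then show "0 \<in> {x. x \<le> u * n \<and> r x \<le> r (x + n - 1) + int m}" by (simp add: start)
qed

lemma cut_mem: "p \<in> {x. x \<le> u * n \<and> r x \<le> r (x + n - 1) + int m}"
  unfolding cut_def using Max_in[OF cut_set(1)] cut_set(2) by (metis empty_iff)

lemma cut_le: "p \<le> u * n"
  and cut_closes: "r p \<le> r (p + n - 1) + int m"
  using cut_mem by simp_all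

lemma after_cut:
  assumes "p < x" "x \<le> u * n"
  shows "r (x + n - 1) + int m < r x"
proof (rule ccontr)
  assume "\<not> r (x + n - 1) + int m < r x"
  then have "x \<in> {x. x \<le> u * n \<and> r x \<le> r (x + n - 1) + int m}"
    using assms(2) by simp
  then have "x \<le> p" unfolding cut_def by (rule Max_ge[OF cut_set(1)])
  with assms(1) show False by simp
qed

text \<open>By maximality of the cut \<open>r (x + n) + m < r (x + 1)\<close>, and the walk climbs by at most
\<open>m\<close> from \<open>x\<close>.\<close>

lemma drop:
  assumes "p \<le> x" "x + n < Suc u * n"
  shows "r (x + n) < r x"
proof -
  have x: "Suc x \<le> u * n" using assms(2) by auto
  have "r (x + n) + int m < r (Suc x)" using after_cut[of "Suc x"] assms(1) x by simp
  moreover have "r (Suc x) \<le> r x + int m" using x n_pos by (intro climb) auto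
  ultimately show ?thesis by simp
qed

lemma drop_many:
  assumes "p \<le> x" "x + k * n < Suc u * n"
  shows "r (x + k * n) \<le> r x" "k \<ge> 1 \<Longrightarrow> r (x + k * n) < r x"
proof -
  have *: "r (x + k * n) \<le> r x \<and> (k \<ge> 1 \<longrightarrow> r (x + k * n) < r x)"
    using assms(2)
  proof (induction k)
    case (Suc k)
    have "r ((x + k * n) + n) < r (x + k * n)"
      using Suc.prems assms(1) by (intro drop) (auto simp: algebra_simps)
    moreover have "r (x + k * n) \<le> r x" using Suc by auto
    ultimately show ?case by (simp add: algebra_simps)
  qed simp
  show "r (x + k * n) \<le> r x" using * by (rule conjunct1)
  show "k \<ge> 1 \<Longrightarrow> r (x + k * n) < r x" using * by blast
qed

lemma congruent_drop:
  assumes "p \<le> x" "x \<le> x'" "x' < Suc u * n" "x' mod n = x mod n"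
  shows "r x' \<le> r x" "x < x' \<Longrightarrow> r x' < r x"
proof -
  have "n dvd x' - x" using assms(2,4) by (metis mod_eq_dvd_iff_nat)
  then obtain k where "x' - x = n * k" by (elim dvdE)
  then have k: "x' = x + k * n" using assms(2) by (simp add: mult.commute)
  show "r x' \<le> r x" using drop_many(1)[of x k] assms k by simp
  assume "x < x'"
  then have "k \<ge> 1" using k by (cases k) auto
  then show "r x' < r x" using drop_many(2)[of x k] assms k by simp
qed

text \<open>A cut at \<open>0\<close> would force \<open>r n < r 0 = 0\<close>.\<close>

lemma cut_pos: assumes "u \<ge> 1" shows "p \<ge> 1"
proof (rule ccontr)
  assume "\<not> p \<ge> 1"
  then have "r (0 + n) < r 0" using assms n_pos by (intro drop) auto
  moreover have "0 \<le> r n" using assms n_pos by (intro nonneg) auto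
  ultimately show False using start by simp
qed

text \<open>Only the new neighbours \<open>p - 1\<close> and \<open>p + n\<close> need an argument, and there
\<open>r (p + n) < r p\<close> suffices.\<close>

lemma removal_walk:
  assumes "u \<ge> 1"
  shows "rank_walk n m (u * n) (\<lambda>x. if x < p then r x else r (x + n))"
  unfolding rank_walk_def
proof (intro conjI allI impI)
  show "(if 0 < p then r 0 else r (0 + n)) = 0" using cut_pos[OF assms] start by simp
  fix x assume x: "x < u * n"
  show "0 \<le> (if x < p then r x else r (x + n))" using x nonneg by auto
  have "int n dvd r (x + n) - int m * int (x + n)" using x by (intro residue) simp
  then have "int n dvd (r (x + n) - int m * int (x + n)) + int n * int m"
    by (intro dvd_add) auto
  then have "int n dvd r (x + n) - int m * int x" by (simp add: algebra_simps)
  then show "int n dvd (if x < p then r x else r (x + n)) - int m * int x"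
    using x residue[of x] by auto
next
  fix x assume x: "Suc x < u * n"
  have c1: "r (Suc x) \<le> r x + int m" and c2: "r (Suc (x + n)) \<le> r (x + n) + int m"
    using x climb by auto
  have "r (Suc x + n) \<le> r x + int m" if "Suc x = p"
  proof -
    have "r (Suc x + n) < r (Suc x)" using that x by (intro drop) auto
    then show ?thesis using c1 by simp
  qed
  then show "(if Suc x < p then r (Suc x) else r (Suc x + n))
      \<le> (if x < p then r x else r (x + n)) + int m"
    using c1 c2 by (cases "Suc x = p") auto
qed

end

text \<open>A later cut at or behind \<open>p\<close> would be a solution of the old closing condition behind
\<open>p\<close>.\<close>

lemma next_cut_less:
  assumes "n \<ge> 1" "u \<ge> 1" "rank_walk n m (Suc u * n) r"
    and r': "r' = (\<lambda>x. if x < cut n m u r then r x else r (x + n))"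
  shows "cut n m (u - 1) r' < cut n m u r"
proof (rule ccontr)
  assume neg: "\<not> cut n m (u - 1) r' < cut n m u r"
  interpret c: cut_walk n m u r using assms by unfold_locales
  obtain v where v: "u = Suc v" using assms(2) by (cases u) auto
  interpret c': cut_walk n m v r'
    using c.removal_walk[OF assms(2)] assms(1) by unfold_locales (simp_all add: r' v)
  have le: "c.p \<le> c'.p" using neg v by simp
  have "r' c'.p = r (c'.p + n)" "r' (c'.p + n - 1) = r ((c'.p + n) + n - 1)"
    using le assms(1) by (auto simp: r')
  moreover have "r ((c'.p + n) + n - 1) + int m < r (c'.p + n)"
    using le c'.cut_le assms(1) v by (intro c.after_cut) auto
  ultimately show False using c'.cut_closes by simp
qed

locale coprime_cut_walk = cut_walk +
  assumes coprime: "coprime m n"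
begin

lemma rank_congruent:
  assumes "x < Suc u * n" "z < Suc u * n"
  shows "int n dvd r x - int m * k - r z \<longleftrightarrow> int n dvd int x - k - int z"
proof -
  have e: "r x - int m * k - r z
      = (r x - int m * int x) - (r z - int m * int z) + int m * (int x - k - int z)"
    by (simp add: algebra_simps)
  have "int n dvd (r x - int m * int x) - (r z - int m * int z)"
    by (rule dvd_diff[OF residue[OF assms(1)] residue[OF assms(2)]])
  then have "int n dvd r x - int m * k - r z \<longleftrightarrow> int n dvd int m * (int x - k - int z)"
    unfolding e by (rule dvd_add_right_iff)
  also have "\<dots> \<longleftrightarrow> int n dvd int x - k - int z"
    using coprime by (simp add: coprime_dvd_mult_right_iff coprime_commute)
  finally show ?thesis .
qed

lemma tie_same:
  assumes "x < Suc u * n" "z < Suc u * n"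
  shows "tie n (r z) (r x) = (if r z < r x \<and> x mod n = z mod n then 1 else 0)"
  using rank_congruent[OF assms, of 0] int_dvd_iff_mod[of n x z] by (simp add: tie_def)

lemma tie_next:
  assumes "x < Suc u * n" "z < Suc u * n"
  shows "tie n (r z) (r x - int m) = (if r z + int m < r x \<and> x mod n = Suc z mod n then 1 else 0)"
proof -
  have "int x - 1 - int z = int x - int (Suc z)" by simp
  then have "int n dvd r x - int m - r z \<longleftrightarrow> x mod n = Suc z mod n"
    using rank_congruent[OF assms, of 1] int_dvd_iff_mod[of n x "Suc z"] by (simp only: mult_1_right)
  moreover have "r z < r x - int m \<longleftrightarrow> r z + int m < r x" by linarith
  ultimately show ?thesis unfolding tie_def by simp
qed

text \<open>For \<open>z\<close> behind the cut, a column after \<open>z\<close> in its residue class has a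
smaller rank, and a column in the next residue class exceeds such a rank by at most
\<open>m\<close>. So both indicators vanish.\<close>

lemma no_tie_after:
  assumes "p \<le> z" "z < x" "x < Suc u * n"
  shows "tie_change n m (r z) (r x) = 0"
proof -
  have z: "z < Suc u * n" using assms by simp
  have "r x < r z" if "x mod n = z mod n"
    using congruent_drop(2)[of z x] that assms by simp
  then have 1: "tie n (r z) (r x) = 0" unfolding tie_same[OF assms(3) z] by auto
  have "r x \<le> r z + int m" if "x mod n = Suc z mod n"
  proof -
    obtain w where w: "x = Suc w" using assms(2) by (cases x) auto
    have "w mod n = z mod n"
      using that w int_dvd_iff_mod[of n "Suc w" "Suc z"] int_dvd_iff_mod[of n w z] by simp
    then have "r w \<le> r z" using assms w by (intro congruent_drop(1)) auto
    moreover have "r x \<le> r w + int m" using climb[of w] assms(3) w by simp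
    ultimately show ?thesis by simp
  qed
  then have 2: "tie n (r z) (r x - int m) = 0" unfolding tie_next[OF assms(3) z] by auto
  show ?thesis by (simp add: tie_change_def 1 2)
qed

text \<open>Here \<open>z\<close> lies behind the removed segment, so exactly one entry of the segment is in
the class of \<open>z\<close> and exactly one in the class of \<open>z + 1\<close>. The first
exceeds \<open>r z\<close> and the second exceeds \<open>r z + m\<close>, so that the two
contributions cancel.\<close>

lemma segment_ties_cancel:
  assumes "p + n \<le> z" "z < Suc u * n"
  shows "(\<Sum>x = p..<p + n. tie_change n m (r z) (r x)) = 0"
proof -
  have same: "tie n (r z) (r x) = (if x mod n = z mod n then 1 else 0)"
    if "x \<in> {p..<p + n}" for x
  proof -
    have "r z < r x" if "x mod n = z mod n"
      using congruent_drop(2)[of x z] that assms \<open>x \<in> _\<close> by simp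
    then show ?thesis using that assms by (subst tie_same) auto
  qed
  have "next": "tie n (r z) (r x - int m) = (if x mod n = Suc z mod n then 1 else 0)"
    if x: "x \<in> {p..<p + n}" for x
  proof -
    have "r z + int m < r x" if c: "x mod n = Suc z mod n"
    proof -
      have c': "(x + n - 1) mod n = z mod n"
      proof -
        have "int n dvd int x - int (Suc z)" using c int_dvd_iff_mod by blast
        then have "int n dvd (int x - int (Suc z)) + int n" by simp
        moreover have "(int x - int (Suc z)) + int n = int (x + n - 1) - int z"
          using n_pos by (simp add: of_nat_diff)
        ultimately have "int n dvd int (x + n - 1) - int z" by (simp only:)
        then show ?thesis by (simp only: int_dvd_iff_mod)
      qed
      have le: "x + n - 1 \<le> z"
      proof (rule ccontr)
        assume "\<not> x + n - 1 \<le> z"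
        moreover from this have "x + n - 1 = z"
          using x assms(1) n_pos by (intro window_inj[OF _ _ _ _ c', of "p + n"]) (simp_all, arith+)
        ultimately show False by simp
      qed
      have z_le: "r z \<le> r (x + n - 1)"
        using x le c' assms n_pos by (intro congruent_drop(1)) auto
      show ?thesis
      proof (cases "x = p")
        case False
        then have "r (x + n - 1) + int m < r x"
          using x le assms(2) by (intro after_cut) auto
        then show ?thesis using z_le by simp
      next
        case True
        \<comment> \<open>here \<open>x + n - 1\<close> is the last column of the segment, so the comparison goes through \<open>p + n\<close>\<close>
        have c2: "(p + n + n - 1) mod n = z mod n"
        proof -
          have "p + n + n - 1 = (x + n - 1) + n" using True n_pos by simp
          then show ?thesis using c' by simp
        qed
        have zz: "p + n + n - 1 \<le> z"
        proof (rule ccontr)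
          assume "\<not> p + n + n - 1 \<le> z"
          moreover from this have "p + n + n - 1 = z"
            using assms(1) n_pos by (intro window_inj[OF _ _ _ _ c2, of "p + n"]) arith+
          ultimately show False by simp
        qed
        have "r z \<le> r (p + n + n - 1)"
          using zz assms n_pos c2 by (intro congruent_drop(1)) auto
        moreover have "r (p + n + n - 1) + int m < r (p + n)"
          using zz assms n_pos by (intro after_cut) auto
        moreover have "r (p + n) < r p" using zz assms n_pos by (intro drop) auto
        ultimately show ?thesis using True by simp
      qed
    qed
    then show ?thesis using x assms by (subst tie_next) auto
  qed
  show ?thesis
    using sum_window_residue[OF n_pos, where p = p and c = z] sum_window_residue[OF n_pos, where p = p and c = "Suc z"]
    by (simp add: tie_change_def sum_subtractf same "next")
qed

end

section \<open>Sets generated by a residue system\<close>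

text \<open>A system of representatives of the residues modulo \<open>N\<close>, which will be the base of a
set closed under adding \<open>N\<close>.\<close>

locale residue_system =
  fixes N :: nat and A :: "nat \<Rightarrow> int"
  assumes N_pos: "N \<ge> 1"
    and A_nonneg: "\<And>x. x < N \<Longrightarrow> 0 \<le> A x"
    and A_distinct: "\<And>x x'. x < N \<Longrightarrow> x' < N \<Longrightarrow> int N dvd A x - A x' \<Longrightarrow> x = x'"
begin

definition gen :: "nat set" where
  "gen = {b. \<exists>x<N. \<exists>k::nat. int b = A x + int N * int k}"

lemma residue_exists: "\<exists>x<N. int N dvd b - A x"
proof -
  let ?f = "\<lambda>x. nat (A x mod int N)"
  have N: "int N > 0" using N_pos by simp
  have "inj_on ?f {..<N}"
  proof (rule inj_onI)
    fix x x' assume x: "x \<in> {..<N}" "x' \<in> {..<N}" "?f x = ?f x'"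
    have "A x mod int N = A x' mod int N"
      using x(3) pos_mod_sign[OF N, of "A x"] pos_mod_sign[OF N, of "A x'"] by linarith
    then show "x = x'" using x A_distinct by (simp add: mod_eq_dvd_iff)
  qed
  moreover have "?f ` {..<N} \<subseteq> {..<N}" using N by (auto simp: nat_less_iff)
  ultimately have "?f ` {..<N} = {..<N}" by (simp add: endo_inj_surj)
  moreover have "nat (b mod int N) \<in> {..<N}" using N by (simp add: nat_less_iff)
  ultimately obtain x where x: "x < N" "nat (b mod int N) = ?f x" by auto
  have "b mod int N = A x mod int N"
    using x(2) pos_mod_sign[OF N, of "A x"] pos_mod_sign[OF N, of b] by linarith
  then show ?thesis using x(1) by (auto simp: mod_eq_dvd_iff)
qed

lemma gen_iff:
  assumes "x < N" "int N dvd int b - A x"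
  shows "b \<in> gen \<longleftrightarrow> A x \<le> int b"
proof
  assume "b \<in> gen"
  then obtain x' k where x': "x' < N" "int b = A x' + int N * int k" by (auto simp: gen_def)
  have "A x' - A x = int b - A x - int N * int k" using x'(2) by simp
  then have "int N dvd A x' - A x" using assms(2) by (simp only: dvd_diff dvd_triv_left)
  then have "x' = x" using A_distinct x'(1) assms(1) by blast
  then show "A x \<le> int b" using x'(2) by simp
next
  assume le: "A x \<le> int b"
  obtain k where k: "int b - A x = int N * k" using assms(2) by (elim dvdE)
  then have "0 \<le> int N * k" using le by simp
  then have "0 \<le> k" using N_pos by (simp add: zero_le_mult_iff)
  then have "int b = A x + int N * int (nat k)" using k by simp
  then show "b \<in> gen" using assms(1) unfolding gen_def by blast
qed

lemma gen_residue:
  obtains x where "x < N" "int N dvd int b - A x" "b \<in> gen \<longleftrightarrow> A x \<le> int b"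
  using residue_exists[of "int b"] gen_iff by blast

lemma base_in_gen: "x < N \<Longrightarrow> nat (A x) \<in> gen"
  using gen_iff[of x "nat (A x)"] A_nonneg[of x] by simp

lemma inj_base: "inj_on (\<lambda>x. nat (A x)) {..<N}"
proof (rule inj_onI)
  fix x x' assume x: "x \<in> {..<N}" "x' \<in> {..<N}" "nat (A x) = nat (A x')"
  then have "A x = A x'" using A_nonneg[of x] A_nonneg[of x'] by simp
  then show "x = x'" using x A_distinct by simp
qed

lemma base_gen:
  assumes "N = d * n"
  shows "base d n gen = (\<lambda>x. nat (A x)) ` {..<N}"
proof -
  have N: "d * n > 0" using N_pos assms by simp
  have prog: "b \<in> progression d n (nat (A x)) \<longleftrightarrow> (\<exists>k::nat. int b = A x + int N * int k)"
    if "x < N" for b x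
  proof -
    have "b = nat (A x) + d * n * k \<longleftrightarrow> int b = A x + int N * int k" for k
    proof -
      have "int (nat (A x) + d * n * k) = A x + int N * int k"
        using A_nonneg[OF that] unfolding assms by simp
      then show ?thesis by linarith
    qed
    then show ?thesis by (simp add: progression_def)
  qed
  have "is_base d n ((\<lambda>x. nat (A x)) ` {..<N}) gen"
    unfolding is_base_def
  proof
    show "gen = \<Union> (progression d n ` (\<lambda>x. nat (A x)) ` {..<N})"
      using prog by (auto simp: gen_def)
    show "disjoint_family_on (progression d n) ((\<lambda>x. nat (A x)) ` {..<N})"
      unfolding disjoint_family_on_def
    proof (clarsimp)
      fix x x' assume x: "x < N" "x' < N" and ne: "nat (A x) \<noteq> nat (A x')"
      show "progression d n (nat (A x)) \<inter> progression d n (nat (A x')) = {}"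
      proof (rule ccontr)
        assume "progression d n (nat (A x)) \<inter> progression d n (nat (A x')) \<noteq> {}"
        then obtain b where "b \<in> progression d n (nat (A x))" "b \<in> progression d n (nat (A x'))"
          by blast
        then obtain k l :: nat where "int b = A x + int N * int k" "int b = A x' + int N * int l"
          unfolding prog[OF x(1)] prog[OF x(2)] by blast
        then have "A x - A x' = int N * (int l - int k)" by (simp add: algebra_simps)
        then have "x = x'" using A_distinct x by simp
        then show False using ne by simp
      qed
    qed
  qed
  then have eq: "(\<lambda>x. nat (A x)) ` {..<N} = {a \<in> gen. \<not> (\<exists>b\<in>gen. a = b + d * n)}"
    and shift: "\<forall>x\<in>gen. x + d * n \<in> gen"
    unfolding is_base_iff[OF N] by blast+
  show ?thesis using base_eq[OF N] shift eq by simp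
qed

text \<open>In the class of \<open>A x\<close> the missing numbers are \<open>A x - N v\<close> with \<open>v
\<ge> 1\<close>.\<close>

lemma missing_card:
  assumes "0 \<le> t"
  shows "int (card {b. t \<le> int b \<and> b \<notin> gen}) = (\<Sum>x<N. reach N t (A x))"
proof -
  have N: "int N > 0" using N_pos by simp
  let ?B = "\<lambda>x. {b. t \<le> int b \<and> int N dvd int b - A x \<and> int b < A x}"
  have fin: "finite (?B x)" for x
    by (rule finite_subset[of _ "{..nat (A x)}"]) auto
  have eq: "{b. t \<le> int b \<and> b \<notin> gen} = (\<Union>x<N. ?B x)"
  proof (intro equalityI subsetI)
    fix b assume b: "b \<in> {b. t \<le> int b \<and> b \<notin> gen}"
    obtain x where "x < N" "int N dvd int b - A x" "b \<in> gen \<longleftrightarrow> A x \<le> int b" by (rule gen_residue)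
    then show "b \<in> (\<Union>x<N. ?B x)" using b by auto
  next
    fix b assume "b \<in> (\<Union>x<N. ?B x)"
    then obtain x where "x < N" "t \<le> int b" "int N dvd int b - A x" "int b < A x" by blast
    then show "b \<in> {b. t \<le> int b \<and> b \<notin> gen}" using gen_iff[of x b] by simp
  qed
  have disj: "?B x \<inter> ?B x' = {}" if "x < N" "x' < N" "x \<noteq> x'" for x x'
  proof (rule ccontr)
    assume "?B x \<inter> ?B x' \<noteq> {}"
    then obtain b where "int N dvd int b - A x" "int N dvd int b - A x'" by blast
    then have "int N dvd (int b - A x') - (int b - A x)" using dvd_diff by blast
    then show False using A_distinct[OF that(1,2)] that(3) by simp
  qed
  have one: "int (card (?B x)) = reach N t (A x)" if x: "x < N" for x
  proof -
    let ?q = "(A x - t) div int N"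
    have "bij_betw (\<lambda>v. nat (A x - int N * v)) {1..?q} (?B x)"
    proof (rule bij_betwI')
      fix v w assume "v \<in> {1..?q}" "w \<in> {1..?q}"
      then have "int N * v \<le> A x - t" "int N * w \<le> A x - t"
        using le_div_iff_mult_le_int[OF N_pos] by auto
      then have "0 \<le> A x - int N * v" "0 \<le> A x - int N * w" using assms by linarith+
      then have "nat (A x - int N * v) = nat (A x - int N * w) \<longleftrightarrow> int N * v = int N * w"
        by (simp add: eq_nat_nat_iff)
      then show "(nat (A x - int N * v) = nat (A x - int N * w)) = (v = w)" using N by simp
    next
      fix v assume v: "v \<in> {1..?q}"
      then have le: "int N * v \<le> A x - t" using le_div_iff_mult_le_int[OF N_pos] by auto
      have "int N * 1 \<le> int N * v" using v by (intro mult_left_mono) auto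
      then show "nat (A x - int N * v) \<in> ?B x" using le assms N by auto
    next
      fix b assume b: "b \<in> ?B x"
      then have "int N dvd A x - int b" by (simp add: dvd_diff_commute)
      then obtain v where v: "A x - int b = int N * v" by (elim dvdE)
      then have "0 < int N * v" using b by simp
      then have "1 \<le> v" using N by (simp add: zero_less_mult_iff)
      moreover have "int N * v \<le> A x - t" using b v by simp
      then have "v \<le> ?q" using le_div_iff_mult_le_int[OF N_pos] by simp
      moreover have "b = nat (A x - int N * v)" using v by linarith
      ultimately show "\<exists>v\<in>{1..?q}. b = nat (A x - int N * v)" by auto
    qed
    then have "card (?B x) = card {1..?q}" by (rule bij_betw_same_card[symmetric])
    then show ?thesis by (simp add: reach_def max_def)
  qed
  have "card (\<Union>x<N. ?B x) = (\<Sum>x<N. card (?B x))"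
    using fin disj by (intro card_UN_disjoint) auto
  then show "int (card {b. t \<le> int b \<and> b \<notin> gen}) = (\<Sum>x<N. reach N t (A x))"
    using one by (simp add: eq)
qed

end

text \<open>The conditions on the ranks \<open>h\<close> of the rows under which the numbers \<open>d h x + x
div n\<close> generate a set closed under addition of the semigroup: \<open>h_row\<close> is
closure under \<open>dm\<close>, and \<open>h_col\<close> is closure under \<open>dmn + 1\<close>
except in the last row. The semigroup itself is the case \<open>h x = m x\<close>.\<close>

locale staircase =
  fixes d n m :: nat and h :: "nat \<Rightarrow> int"
  assumes d_pos: "d \<ge> 1" and n_pos: "n \<ge> 1" and coprime: "coprime m n"
    and h_0: "h 0 = 0"
    and h_nonneg: "\<And>x. x < d * n \<Longrightarrow> 0 \<le> h x"
    and h_residue: "\<And>x. x < d * n \<Longrightarrow> int n dvd h x - int m * int x"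
    and h_row: "\<And>x. x < d * n \<Longrightarrow> h (x div n * n + Suc x mod n) \<le> h x + int m"
    and h_col: "\<And>x. x + n < d * n \<Longrightarrow> h (x + n) \<le> h x + int m * int n"
begin

abbreviation generator :: "nat \<Rightarrow> int" where
  "generator x \<equiv> int d * h x + int (x div n)"

lemma h_le: "x < d * n \<Longrightarrow> h x \<le> int m * int x"
proof (induction x rule: less_induct)
  case (less x)
  show ?case
  proof (cases "x < n")
    case True
    show ?thesis
    proof (cases x)
      case (Suc w)
      have "h (w div n * n + Suc w mod n) \<le> h w + int m"
        using less.prems Suc by (intro h_row) simp
      then have "h (Suc w) \<le> h w + int m" using True Suc by simp
      moreover have "h w \<le> int m * int w" using less Suc by simp
      ultimately show ?thesis using Suc by (simp add: algebra_simps)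
    qed (simp add: h_0)
  next
    case False
    then obtain w where w: "x = w + n" by (metis add.commute le_Suc_ex linorder_not_less)
    have "h x \<le> h w + int m * int n" using h_col[of w] less.prems w by simp
    moreover have "h w \<le> int m * int w" using less w n_pos by simp
    ultimately show ?thesis using w by (simp add: algebra_simps)
  qed
qed

lemma residue_diff:
  assumes "x < d * n" "x' < d * n"
  shows "int n dvd h x + a - h x' \<longleftrightarrow> int n dvd int m * int x + a - int m * int x'"
proof -
  have "int n dvd (h x - int m * int x) - (h x' - int m * int x')"
    by (rule dvd_diff[OF h_residue[OF assms(1)] h_residue[OF assms(2)]])
  moreover have "h x + a - h x' = ((h x - int m * int x) - (h x' - int m * int x'))
      + (int m * int x + a - int m * int x')" by simp
  ultimately show ?thesis by (metis dvd_add_right_iff)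
qed

sublocale residue_system "d * n" generator
proof
  show "1 \<le> d * n" using d_pos n_pos by simp
  show "0 \<le> generator x" if "x < d * n" for x using h_nonneg[OF that] by simp
  show "x = x'" if x: "x < d * n" "x' < d * n" and dv: "int (d * n) dvd generator x - generator x'" for x x'
  proof -
    have i: "x div n < d" "x' div n < d" using x by (simp_all add: less_mult_imp_div_less)
    have e: "generator x - generator x' = int d * (h x - h x') + (int (x div n) - int (x' div n))"
      by (simp add: algebra_simps)
    have "int d dvd generator x - generator x'" using dv by (metis dvd_mult_left of_nat_mult)
    then have "int d dvd int (x div n) - int (x' div n)"
      unfolding e by (simp add: dvd_add_right_iff)
    then have "int (x div n) mod int d = int (x' div n) mod int d" by (simp add: mod_eq_dvd_iff)
    then have q: "x div n = x' div n" using i by simp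
    then have "int d * int n dvd int d * (h x - h x')" using dv e by simp
    then have "int n dvd h x + 0 - h x'" using d_pos by simp
    then have "int n dvd int m * int x + 0 - int m * int x'" using residue_diff[OF x] by blast
    then have "int n dvd int m * (int x - int x')" by (simp add: algebra_simps)
    then have "int n dvd int x - int x'"
      using coprime by (simp add: coprime_dvd_mult_right_iff coprime_commute)
    then have "x mod n = x' mod n" by (metis mod_eq_dvd_iff of_nat_eq_iff of_nat_mod)
    then show ?thesis using q by (metis div_mult_mod_eq)
  qed
qed

lemma gen_shift:
  assumes b: "b \<in> gen"
    and step: "\<And>x. x < d * n \<Longrightarrow> \<exists>x'<d * n. generator x' \<le> generator x + int s \<and> int (d * n) dvd generator x + int s - generator x'"
  shows "b + s \<in> gen"
proof -
  obtain x where x: "x < d * n" "int (d * n) dvd int b - generator x" "b \<in> gen \<longleftrightarrow> generator x \<le> int b"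
    by (rule gen_residue)
  obtain x' where x': "x' < d * n" "generator x' \<le> generator x + int s" "int (d * n) dvd generator x + int s - generator x'"
    using step[OF x(1)] by blast
  have "int (d * n) dvd (int b - generator x) + (generator x + int s - generator x')" by (rule dvd_add[OF x(2) x'(3)])
  moreover have "(int b - generator x) + (generator x + int s - generator x') = int (b + s) - generator x'" by simp
  ultimately have "int (d * n) dvd int (b + s) - generator x'" by (simp only:)
  moreover have "generator x' \<le> int (b + s)" using x(3) b x'(2) by simp
  ultimately show ?thesis using gen_iff[OF x'(1)] by blast
qed

lemma gen_add_dn: "b \<in> gen \<Longrightarrow> b + d * n \<in> gen"
  by (erule gen_shift) auto

lemma gen_add_dm: "b \<in> gen \<Longrightarrow> b + d * m \<in> gen"
proof (erule gen_shift)
  fix x assume x: "x < d * n"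
  let ?r = "x div n * n + Suc x mod n"
  have "Suc (x div n) \<le> d" using x by (simp add: less_mult_imp_div_less Suc_leI)
  then have "Suc (x div n) * n \<le> d * n" by (rule mult_le_mono1)
  moreover have "?r < Suc (x div n) * n" using n_pos by simp
  ultimately have r: "?r < d * n" by simp
  have rd: "?r div n = x div n" using n_pos by simp
  have e: "generator x + int (d * m) - generator ?r = int d * (h x + int m - h ?r)"
    unfolding rd by (simp add: algebra_simps)
  have "?r mod n = Suc x mod n" by simp
  then have "int n dvd int (Suc x) - int ?r" by (metis mod_eq_dvd_iff of_nat_mod)
  then have "int n dvd int m * (int (Suc x) - int ?r)" by (rule dvd_mult)
  moreover have "int m * (int (Suc x) - int ?r) = int m * int x + int m - int m * int ?r"
    by (simp add: algebra_simps)
  ultimately have "int n dvd int m * int x + int m - int m * int ?r" by (simp only:)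
  then have "int n dvd h x + int m - h ?r" using residue_diff[OF x r] by blast
  then have "int (d * n) dvd generator x + int (d * m) - generator ?r" unfolding e by simp
  moreover have "0 \<le> generator x + int (d * m) - generator ?r"
    unfolding e using h_row[OF x] by (intro mult_nonneg_nonneg) auto
  ultimately show "\<exists>x'<d * n. generator x' \<le> generator x + int (d * m) \<and> int (d * n) dvd generator x + int (d * m) - generator x'"
    using r by (intro exI[of _ ?r]) auto
qed

text \<open>From the last row, adding \<open>dmn + 1\<close> leads to row \<open>0\<close>; there every rank
is at most \<open>m (n - 1)\<close>, so that the sum is large enough whatever its residue is.\<close>

lemma gen_add_dmn1: "b \<in> gen \<Longrightarrow> b + (d * m * n + 1) \<in> gen"
proof (erule gen_shift)
  fix x assume x: "x < d * n"
  let ?s = "d * m * n + 1"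
  show "\<exists>x'<d * n. generator x' \<le> generator x + int ?s \<and> int (d * n) dvd generator x + int ?s - generator x'"
  proof (cases "x + n < d * n")
    case True
    have "(x + n) div n = Suc (x div n)" using n_pos by simp
    then have e: "generator x + int ?s - generator (x + n) = int d * (h x + int m * int n - h (x + n))"
      by (simp add: algebra_simps)
    have "int m * int x + int m * int n - int m * int (x + n) = 0" by (simp add: algebra_simps)
    then have "int n dvd h x + int m * int n - h (x + n)" using residue_diff[OF x True] by simp
    then have "int (d * n) dvd generator x + int ?s - generator (x + n)" unfolding e by simp
    moreover have "0 \<le> generator x + int ?s - generator (x + n)"
      unfolding e using h_col[OF True] by (intro mult_nonneg_nonneg) auto
    ultimately show ?thesis using True by (intro exI[of _ "x + n"]) auto
  next
    case False
    \<comment> \<open>the position in row \<open>0\<close> of the residue of the sum\<close>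
    obtain j where j: "j < n" "int n dvd int m * int j - (int m * int x + 1)"
      using residue_solution[OF n_pos coprime] by blast
    have jN: "j < d * n" using j(1) d_pos by (metis less_le_trans mult.commute mult_le_mono2 mult.right_neutral)
    have "d * n = (d - 1) * n + n" using d_pos by (cases d) auto
    then have "x div n = d - 1"
      using False x n_pos by (intro div_nat_eqI) (auto simp: mult.commute)
    then have e: "generator x + int ?s - generator j = int d * (h x + (1 + int m * int n) - h j)"
      using d_pos j(1) by (simp add: algebra_simps of_nat_diff)
    have "int n dvd int m * int n - (int m * int j - (int m * int x + 1))"
      by (rule dvd_diff[OF dvd_triv_right j(2)])
    then have "int n dvd int m * int x + (1 + int m * int n) - int m * int j"
      by (simp add: algebra_simps)
    then have "int n dvd h x + (1 + int m * int n) - h j" using residue_diff[OF x jN] by blast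
    then have "int (d * n) dvd generator x + int ?s - generator j" unfolding e by simp
    moreover have "0 \<le> h x + (1 + int m * int n) - h j"
    proof -
      have "int m * int j \<le> int m * int n" using j(1) by (intro mult_left_mono) auto
      then show ?thesis using h_le[OF jN] h_nonneg[OF x] by linarith
    qed
    then have "0 \<le> generator x + int ?s - generator j" unfolding e by simp
    ultimately show ?thesis using jN by (intro exI[of _ j]) auto
  qed
qed

lemma Gam_gen: assumes "g \<in> Gam d n m" "b \<in> gen" shows "g + b \<in> gen"
proof -
  obtain i j k where g: "g = i * (d * n) + j * (d * m) + k * (d * m * n + 1)"
    using assms(1) by (auto simp: Gam_def)
  have it: "b + l * s \<in> gen" if "b \<in> gen" "\<And>b. b \<in> gen \<Longrightarrow> b + s \<in> gen" for b l s
  proof (induction l)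
    case (Suc l)
    then show ?case using that(2)[of "b + l * s"] by (simp add: algebra_simps)
  qed (use that in simp)
  have "b + i * (d * n) + j * (d * m) + k * (d * m * n + 1) \<in> gen"
    using it[OF it[OF it[OF assms(2) gen_add_dn] gen_add_dm] gen_add_dmn1] .
  then show ?thesis by (simp add: g ac_simps)
qed

lemma zero_in_gen: "0 \<in> gen"
  using base_in_gen[of 0] d_pos n_pos h_0 by simp

end

lemma int_a_hat:
  assumes "n \<ge> 1"
  shows "int (a_hat d n m x) = int d * (int m * int x) + int (x div n)"
proof -
  have "int x = int n * int (x div n) + int (x mod n)"
    by (metis mult_div_mod_eq of_nat_add of_nat_mult)
  then show ?thesis by (simp add: a_hat_def algebra_simps)
qed

text \<open>The semigroup is the staircase set with \<open>h x = m x\<close>, and then each class modulo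
\<open>dn\<close> misses \<open>\<lfloor>m x / n\<rfloor>\<close> numbers.\<close>

lemma delta_eq:
  assumes "d \<ge> 1" "n \<ge> 1" "coprime m n"
  shows "int (delta d n m) = (\<Sum>x<d * n. int (m * x) div int n)"
proof -
  interpret s: staircase d n m "\<lambda>x. int m * int x"
  proof
    fix x
    have "x div n * n + Suc x mod n \<le> Suc x"
      by (metis Suc_leI div_le_mono div_mult_mod_eq le_add1 mult_le_mono1 add_le_mono plus_1_eq_Suc
          le_Suc_eq order_refl)
    then have "int m * int (x div n * n + Suc x mod n) \<le> int m * int (Suc x)"
      by (intro mult_left_mono of_nat_mono) auto
    then show "int m * int (x div n * n + Suc x mod n) \<le> int m * int x + int m"
      by (simp add: algebra_simps)
  qed (use assms in \<open>auto simp: algebra_simps\<close>)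
  have "Gam d n m = s.gen"
  proof (intro equalityI subsetI)
    fix g assume "g \<in> Gam d n m"
    then show "g \<in> s.gen" using s.Gam_gen[OF _ s.zero_in_gen, of g] by simp
  next
    fix b assume "b \<in> s.gen"
    then obtain x k :: nat where b: "int b = int d * (int m * int x) + int (x div n) + int (d * n) * int k"
      by (auto simp: s.gen_def)
    then have "int b = int (k * (d * n) + x mod n * (d * m) + x div n * (d * m * n + 1))"
      unfolding int_a_hat[OF assms(2), symmetric] by (simp add: a_hat_def algebra_simps)
    then have "b = k * (d * n) + x mod n * (d * m) + x div n * (d * m * n + 1)"
      by (simp only: of_nat_eq_iff)
    then show "b \<in> Gam d n m" unfolding Gam_def by blast
  qed
  then have "UNIV - Gam d n m = {b. 0 \<le> int b \<and> b \<notin> s.gen}" by auto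
  then have "int (delta d n m)
      = (\<Sum>x<d * n. reach (d * n) 0 (int d * (int m * int x) + int (x div n)))"
    using s.missing_card[of 0] by (simp add: delta_def)
  also have "\<dots> = (\<Sum>x<d * n. int (m * x) div int n)"
  proof (intro sum.cong refl)
    fix x assume "x \<in> {..<d * n}"
    then have "x div n < d" by (simp add: less_mult_imp_div_less)
    then have "(int d * (int m * int x) + int (x div n)) div int (d * n) = int (m * x) div int n"
      using div_add_digit[of "x div n" d "int m * int x" n] by (simp only: of_nat_mult)
    moreover have "0 \<le> int (m * x) div int n" by (simp add: div_int_pos_iff)
    ultimately show "reach (d * n) 0 (int d * (int m * int x) + int (x div n)) = int (m * x) div int n"
      by (simp only: reach_def diff_0_right max_absorb2)
  qed
  finally show ?thesis .
qed

section \<open>The successive cuts of a Dyck path\<close>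

locale dyck =
  fixes d n m :: nat and y :: "int list"
  assumes d_pos: "d \<ge> 1" and n_pos: "n \<ge> 1" and coprime: "coprime m n"
    and path: "y \<in> dyck_paths d n m"
begin

abbreviation rank :: "nat \<Rightarrow> int" where
  "rank x \<equiv> rk n m x (height d n m y x)"

text \<open>The rank walk with \<open>(u + 1) n\<close> columns from which the segment with index
\<open>u\<close> is removed.\<close>

definition stage :: "nat \<Rightarrow> nat \<Rightarrow> int" where
  "stage u = rk_seq d n m y (d - 1 - u)"

abbreviation P :: "nat \<Rightarrow> nat" where
  "P u \<equiv> p_cut d n m y u"

text \<open>The cycle \<open>s\<^sub>j\<^sub>,\<^sub>u\<close> as a map on columns: it sends a column of the
shorter walk to its position in the longer one, and row \<open>u\<close> to the removed segment,
keeping residues modulo \<open>n\<close>.\<close>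

definition step :: "nat \<Rightarrow> nat \<Rightarrow> nat" where
  "step u x = s_cycle d n m y (x mod n) u (x div n) * n + x mod n"

text \<open>The position, in the walk of stage \<open>u\<close>, of an entry of the final array.\<close>

definition move :: "nat \<Rightarrow> nat \<Rightarrow> nat" where
  "move u x = s_comp d n m y (x mod n) u (x div n) * n + x mod n"

lemma path_bounds:
  assumes "x < d * n"
  shows "0 \<le> y ! x" "y ! x \<le> int (a_bound n m x)"
    "height d n m y x \<le> height d n m y (Suc x)"
  using path assms by (auto simp: dyck_paths_def)

lemma length_path: "length y = d * n"
  using path by (simp add: dyck_paths_def)

lemma height_inside: "x < d * n \<Longrightarrow> height d n m y x = y ! x"
  by (simp add: height_def)

lemma a_bound_eq: "a_bound n m x = (m * x) div n"
proof -
  have "m * x = (x mod n) * m + (m * (x div n)) * n"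
    by (metis add.commute distrib_left mult.assoc mult.commute mult_div_mod_eq)
  then show ?thesis using n_pos by (simp add: a_bound_def)
qed

lemma rank_0: "rank 0 = 0"
proof -
  have "0 < d * n" using d_pos n_pos by simp
  then have "y ! 0 = 0" "height d n m y 0 = y ! 0"
    using path_bounds[of 0] by (auto simp: a_bound_def height_inside)
  then show ?thesis by (simp add: rk_def)
qed

lemma rank_end: "rank (d * n) = 0"
  by (simp add: rk_def height_def)

lemma rank_nonneg: assumes "x \<le> d * n" shows "0 \<le> rank x"
proof (cases "x = d * n")
  case False
  then have x: "x < d * n" using assms by simp
  have "int n * (y ! x) \<le> int n * int (m * x div n)"
    using path_bounds[OF x] by (intro mult_left_mono) (simp_all add: a_bound_eq)
  also have "\<dots> = int (n * (m * x div n))" by simp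
  also have "\<dots> \<le> int (m * x)" by (simp only: of_nat_le_iff times_div_less_eq_dividend)
  finally show ?thesis by (simp add: rk_def height_inside[OF x])
qed (simp add: rank_end)

lemma rank_walk_start: "rank_walk n m (d * n) (\<lambda>x. rk n m x (y ! x))"
  unfolding rank_walk_def
proof (intro conjI allI impI)
  have "0 < d * n" using d_pos n_pos by simp
  then show "rk n m 0 (y ! 0) = 0" using rank_0 height_inside by simp
  fix x assume x: "x < d * n"
  show "0 \<le> rk n m x (y ! x)" using rank_nonneg[of x] x height_inside by simp
  show "int n dvd rk n m x (y ! x) - int m * int x" by (simp add: rk_def)
next
  fix x assume x: "Suc x < d * n"
  have "int n * (y ! x) \<le> int n * (y ! Suc x)"
    using path_bounds(3)[of x] x height_inside by (intro mult_left_mono) auto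
  then show "rk n m (Suc x) (y ! Suc x) \<le> rk n m x (y ! x) + int m"
    by (simp add: rk_def algebra_simps)
qed

lemma stage_top: "stage (d - 1) = (\<lambda>x. rk n m x (y ! x))"
  by (simp add: stage_def)

lemma cut_stage: assumes "u < d" shows "P u = cut n m u (stage u)"
proof -
  have "d - u - 1 = d - 1 - u" by simp
  then show ?thesis by (simp add: p_cut_def stage_def)
qed

lemma stage_Suc:
  assumes "Suc u < d"
  shows "stage u = (\<lambda>x. if x < P (Suc u) then stage (Suc u) x else stage (Suc u) (x + n))"
proof -
  have "d - 1 - u = Suc (d - 1 - Suc u)" "d - 1 - (d - 1 - Suc u) = Suc u" using assms by auto
  then have "stage u = (\<lambda>x. if x < cut n m (Suc u) (stage (Suc u)) then stage (Suc u) x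
      else stage (Suc u) (x + n))"
    unfolding stage_def by (simp only: rk_seq.simps)
  then show ?thesis by (simp only: cut_stage[OF assms])
qed

lemma stage_walk: assumes "u < d" shows "rank_walk n m (Suc u * n) (stage u)"
proof -
  have "rank_walk n m (Suc (d - 1 - k) * n) (stage (d - 1 - k))" if "k < d" for k
    using that
  proof (induction k)
    case 0
    then show ?case using rank_walk_start stage_top by simp
  next
    case (Suc k)
    define u where "u = d - 1 - Suc k"
    have u: "d - 1 - k = Suc u" "Suc u < d" using Suc.prems by (auto simp: u_def)
    interpret c: cut_walk n m "Suc u" "stage (Suc u)"
      using Suc u n_pos by unfold_locales auto
    show ?case
      using c.removal_walk unfolding u_def[symmetric] stage_Suc[OF u(2)] cut_stage[OF u(2)] by simp
  qed
  from this[of "d - 1 - u"] assms show ?thesis by simp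
qed

lemma stage_locale: "u < d \<Longrightarrow> coprime_cut_walk n m u (stage u)"
  using n_pos coprime stage_walk by unfold_locales

lemma P_le: "u < d \<Longrightarrow> P u \<le> u * n"
  using coprime_cut_walk.axioms(1)[OF stage_locale, THEN cut_walk.cut_le] cut_stage by simp

lemma P_0: "P 0 = 0"
  using P_le[of 0] d_pos by simp

lemma i_cut:
  assumes "u < d"
  shows "i_cut d n m y j u \<le> u" "P u \<le> i_cut d n m y j u * n + j"
    "i < i_cut d n m y j u \<Longrightarrow> i * n + j < P u"
proof -
  let ?S = "{i. i \<le> u \<and> P u \<le> i * n + j}"
  have fin: "finite ?S" by simp
  have "u \<in> ?S" using P_le[OF assms] by simp
  then have mem: "Min ?S \<in> ?S" using Min_in[OF fin] by blast
  then show "i_cut d n m y j u \<le> u" "P u \<le> i_cut d n m y j u * n + j"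
    by (simp_all add: i_cut_def)
  assume "i < i_cut d n m y j u"
  then have i: "i < Min ?S" by (simp add: i_cut_def)
  then have "i \<notin> ?S" using Min_le[OF fin, of i] by (meson not_less)
  then show "i * n + j < P u" using i mem by simp
qed

lemma step_mod: "step u x mod n = x mod n"
  by (simp add: step_def)

lemma step_low:
  assumes "u < d" "x < u * n"
  shows "step u x = (if x < P u then x else x + n)"
proof -
  let ?i = "x div n" and ?j = "x mod n" and ?c = "i_cut d n m y (x mod n) u"
  have i: "?i < u" using assms(2) by (simp add: less_mult_imp_div_less)
  have x: "?i * n + ?j = x" by simp
  have "?c \<le> ?i \<longleftrightarrow> P u \<le> x"
  proof
    assume "?c \<le> ?i"
    then have "?c * n + ?j \<le> ?i * n + ?j" by (intro add_right_mono mult_right_mono) simp_all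
    then show "P u \<le> x" using i_cut(2)[OF assms(1), of ?j] x by linarith
  next
    assume "P u \<le> x"
    then show "?c \<le> ?i" using i_cut(3)[OF assms(1), of ?i ?j] x by linarith
  qed
  then show ?thesis using i by (auto simp: step_def s_cycle_def)
qed

lemma step_row:
  assumes "u < d" "u * n \<le> x" "x < Suc u * n"
  shows "P u \<le> step u x" "step u x < P u + n"
proof -
  let ?j = "x mod n" and ?c = "i_cut d n m y (x mod n) u"
  have "x div n = u" using assms(2,3) n_pos by (intro div_nat_eqI) (auto simp: mult.commute)
  then have s: "step u x = ?c * n + ?j" by (simp add: step_def s_cycle_def)
  show "P u \<le> step u x" using i_cut(2)[OF assms(1)] s by simp
  show "step u x < P u + n"
  proof (cases ?c)
    case 0
    then show ?thesis using s n_pos by (simp add: trans_less_add2)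
  next
    case (Suc i)
    then show ?thesis using s i_cut(3)[OF assms(1), of i ?j] by simp
  qed
qed

lemma step_high: assumes "Suc u * n \<le> x" shows "step u x = x"
proof -
  have "Suc u \<le> x div n" using assms n_pos by (simp add: less_eq_div_iff_mult_less_eq)
  then show ?thesis by (simp add: step_def s_cycle_def)
qed

text \<open>There is no cycle with index \<open>0\<close>. Since the last cut is at \<open>0\<close>, row
\<open>0\<close> can nevertheless be treated like the other rows.\<close>

lemma step_0: "step 0 x = x"
proof (cases "x < n")
  case True
  then have "step 0 x < n" using step_row[of 0 x] d_pos P_0 by simp
  then show ?thesis using True step_mod[of 0 x] by simp
qed (use step_high in auto)

lemma move_0: "move 0 x = step 0 x"
  unfolding step_0 by (simp add: move_def)

lemma move_Suc: "move (Suc u) x = step (Suc u) (move u x)"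
  using n_pos by (simp add: move_def step_def)

lemma move_mod: "move u x mod n = x mod n"
  by (simp add: move_def)

lemma move_high: "Suc u * n \<le> x \<Longrightarrow> move u x = x"
proof (induction u)
  case 0 then show ?case by (simp add: move_0 step_0)
next
  case (Suc u) then show ?case by (simp add: move_Suc step_high)
qed

lemma move_row: "u * n \<le> x \<Longrightarrow> move u x = step u x"
  by (cases u) (auto simp: move_0 move_Suc move_high)

lemma step_bij_low:
  assumes "u < d"
  shows "bij_betw (step u) {..<u * n} ({..<P u} \<union> {P u + n..<Suc u * n})"
proof (rule bij_betw_imageI)
  show "inj_on (step u) {..<u * n}"
    by (rule inj_onI) (auto simp: step_low[OF assms] split: if_splits)
  show "step u ` {..<u * n} = {..<P u} \<union> {P u + n..<Suc u * n}"
  proof (intro equalityI subsetI)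
    fix z assume "z \<in> {..<P u} \<union> {P u + n..<Suc u * n}"
    then consider "z < P u" | "P u + n \<le> z" "z < Suc u * n" by auto
    then show "z \<in> step u ` {..<u * n}"
    proof cases
      case 1
      then have "z < u * n" using P_le[OF assms] by simp
      with 1 show ?thesis by (intro image_eqI[of _ _ z]) (auto simp: step_low[OF assms])
    next
      case 2
      then have "z - n < u * n" "P u \<le> z - n" "z - n + n = z" by auto
      then show ?thesis by (intro image_eqI[of _ _ "z - n"]) (auto simp: step_low[OF assms])
    qed
  qed (use P_le[OF assms] in \<open>auto simp: step_low[OF assms]\<close>)
qed

lemma step_bij_row:
  assumes "u < d"
  shows "bij_betw (step u) {u * n..<Suc u * n} {P u..<P u + n}"
proof (rule bij_betw_imageI)
  show inj: "inj_on (step u) {u * n..<Suc u * n}"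
  proof (rule inj_onI)
    fix a b assume "a \<in> {u * n..<Suc u * n}" "b \<in> {u * n..<Suc u * n}" "step u a = step u b"
    moreover from this have "a mod n = b mod n" by (metis step_mod)
    ultimately show "a = b" by (intro window_inj[of "u * n" a n b]) simp_all
  qed
  show "step u ` {u * n..<Suc u * n} = {P u..<P u + n}"
  proof (rule card_subset_eq)
    show "card (step u ` {u * n..<Suc u * n}) = card {P u..<P u + n}"
      unfolding card_image[OF inj] by simp
  qed (auto simp: step_row[OF assms])
qed

lemma step_bij:
  assumes "u < d"
  shows "bij_betw (step u) {..<Suc u * n} {..<Suc u * n}"
proof -
  have "bij_betw (step u) ({..<u * n} \<union> {u * n..<Suc u * n})
      (({..<P u} \<union> {P u + n..<Suc u * n}) \<union> {P u..<P u + n})"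
    by (rule bij_betw_combine[OF step_bij_low[OF assms] step_bij_row[OF assms]]) auto
  moreover have "{..<u * n} \<union> {u * n..<Suc u * n} = {..<Suc u * n}" by auto
  moreover have "({..<P u} \<union> {P u + n..<Suc u * n}) \<union> {P u..<P u + n} = {..<Suc u * n}"
    using P_le[OF assms] by auto
  ultimately show ?thesis by simp
qed

lemma move_bij: "u < d \<Longrightarrow> bij_betw (move u) {..<Suc u * n} {..<Suc u * n}"
proof (induction u)
  case 0
  have "move 0 = step 0" by (rule ext) (rule move_0)
  then show ?case using step_bij[OF 0] by simp
next
  case (Suc u)
  have "bij_betw (move u) {Suc u * n..<Suc (Suc u) * n} {Suc u * n..<Suc (Suc u) * n}"
    by (subst bij_betw_cong[of _ _ id]) (auto simp: move_high bij_betw_id)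
  then have "bij_betw (move u) ({..<Suc u * n} \<union> {Suc u * n..<Suc (Suc u) * n})
      ({..<Suc u * n} \<union> {Suc u * n..<Suc (Suc u) * n})"
    using Suc by (intro bij_betw_combine) auto
  moreover have "{..<Suc u * n} \<union> {Suc u * n..<Suc (Suc u) * n} = {..<Suc (Suc u) * n}" by auto
  ultimately have "bij_betw (step (Suc u) \<circ> move u) {..<Suc (Suc u) * n} {..<Suc (Suc u) * n}"
    using step_bij[OF Suc.prems] by (metis bij_betw_trans)
  moreover have "move (Suc u) = step (Suc u) \<circ> move u" by (rule ext) (simp add: move_Suc)
  ultimately show ?case by (simp only:)
qed

lemma move_less: "u < d \<Longrightarrow> x < Suc u * n \<Longrightarrow> move u x < Suc u * n"
  using move_bij[of u] by (auto simp: bij_betw_def)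

lemma stage_step:
  assumes "Suc u < d" "x < Suc u * n"
  shows "stage u x = stage (Suc u) (step (Suc u) x)"
  using assms by (simp add: stage_Suc step_low)

text \<open>The column of the path from which the entry at position \<open>z\<close> of the array is taken.\<close>

definition sigma :: "nat \<Rightarrow> nat" where
  "sigma = move (d - 1)"

definition row_rank :: "nat \<Rightarrow> int" where
  "row_rank z = rk n m (sigma z) (y ! sigma z)"

text \<open>A column keeps its rank while other segments are removed.\<close>

lemma row_rank_stage:
  assumes "u < d" "z < Suc u * n"
  shows "row_rank z = stage u (move u z)"
proof -
  have "stage (u + k) (move (u + k) z) = stage u (move u z)" if "u + k < d" for k
    using that
  proof (induction k)
    case (Suc k)
    have "z < Suc (u + k) * n" using assms(2) by (simp add: add_mult_distrib)
    then have "move (u + k) z < Suc (u + k) * n" using Suc.prems by (intro move_less) auto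
    then show ?case using Suc by (simp add: stage_step move_Suc)
  qed simp
  from this[of "d - 1 - u"] have "stage (d - 1) (move (d - 1) z) = stage u (move u z)"
    using assms(1) by simp
  then show ?thesis unfolding row_rank_def sigma_def stage_top .
qed

lemma row_rank_row:
  assumes "u < d" "u * n \<le> z" "z < Suc u * n"
  shows "row_rank z = stage u (step u z)"
  using row_rank_stage[OF assms(1,3)] move_row[OF assms(2)] by simp

lemma sigma_bij: "bij_betw sigma {..<d * n} {..<d * n}"
  using move_bij[of "d - 1"] d_pos by (simp add: sigma_def)

lemma sigma_mod: "sigma x mod n = x mod n"
  by (simp add: sigma_def move_mod)

lemma row_rank_nonneg: assumes "z < d * n" shows "0 \<le> row_rank z"
proof -
  have "sigma z < d * n" using sigma_bij assms by (auto simp: bij_betw_def)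
  then show ?thesis using rank_nonneg[of "sigma z"] height_inside by (simp add: row_rank_def)
qed

end

section \<open>The rows formed by the removed segments\<close>

context dyck
begin

text \<open>The cyclic successor within a row.\<close>

abbreviation row_next :: "nat \<Rightarrow> nat" where
  "row_next x \<equiv> x div n * n + Suc x mod n"

lemma row_div: "u * n \<le> x \<Longrightarrow> x < Suc u * n \<Longrightarrow> x div n = u"
  using n_pos by (intro div_nat_eqI) (auto simp: mult.commute)

lemma row_next_row:
  assumes "u * n \<le> x" "x < Suc u * n"
  shows "u * n \<le> row_next x" "row_next x < Suc u * n"
  using row_div[OF assms] n_pos by auto

text \<open>Inside the removed segment this is the climb of the walk; from its last column to its first column
it is the defining inequality of the cut.\<close>

lemma row_climb:
  assumes u: "u < d" and x: "u * n \<le> x" "x < Suc u * n"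
  shows "row_rank (row_next x) \<le> row_rank x + int m"
proof -
  interpret c: coprime_cut_walk n m u "stage u" by (rule stage_locale[OF u])
  note P = cut_stage[OF u, symmetric]
  let ?a = "step u x" and ?b = "step u (row_next x)"
  have a: "P u \<le> ?a" "?a < P u + n" using step_row[OF u x] by auto
  have b: "P u \<le> ?b" "?b < P u + n" using step_row[OF u row_next_row[OF x]] by auto
  have mod: "?b mod n = Suc ?a mod n"
  proof -
    have "?b mod n = Suc x mod n" unfolding step_mod by simp
    also have "\<dots> = Suc (x mod n) mod n" by (simp only: mod_Suc_eq)
    also have "\<dots> = Suc (?a mod n) mod n" by (simp only: step_mod)
    also have "\<dots> = Suc ?a mod n" by (simp only: mod_Suc_eq)
    finally show ?thesis .
  qed
  have "stage u ?b \<le> stage u ?a + int m"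
  proof (cases "Suc ?a < P u + n")
    case True
    then have "?b = Suc ?a" using a b by (intro window_inj[OF _ _ _ _ mod, of "P u"]) simp_all
    moreover have "Suc ?a < Suc u * n" using True P_le[OF u] by simp
    ultimately show ?thesis using c.climb[of ?a] by simp
  next
    case False
    then have eq: "Suc ?a = P u + n" using a by simp
    then have "?b mod n = P u mod n" using mod by simp
    then have "?b = P u" using b n_pos by (intro window_inj[of "P u" ?b n "P u"]) simp_all
    moreover have "?a = P u + n - 1" using eq by simp
    ultimately show ?thesis using c.cut_closes P by simp
  qed
  then show ?thesis using row_rank_row[OF u x] row_rank_row[OF u row_next_row[OF x]] by simp
qed

text \<open>Let \<open>w\<close> be the column before the cut of row \<open>u + 1\<close>. The next cut lies
at or before \<open>w\<close>, so ranks decrease from it on along residue classes, and the entry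
of row \<open>u\<close> in the class of \<open>w\<close> has at least the rank of
\<open>w\<close>. The cut itself is at most \<open>m\<close> higher than \<open>w\<close>.\<close>

lemma row_link:
  assumes u: "Suc u < d"
  shows "\<exists>x. u * n \<le> x \<and> x < Suc u * n \<and> row_rank (row_next x + n) \<le> row_rank x + int m"
proof -
  have u': "u < d" using u by simp
  interpret c: coprime_cut_walk n m "Suc u" "stage (Suc u)" by (rule stage_locale[OF u])
  interpret c': coprime_cut_walk n m u "stage u" by (rule stage_locale[OF u'])
  have P: "c.p = P (Suc u)" "c'.p = P u" using cut_stage u u' by simp_all
  have less: "P u < P (Suc u)"
    using next_cut_less[OF n_pos _ c.walk stage_Suc[OF u, unfolded P(1)[symmetric]]] P by simp
  obtain w where w: "P (Suc u) = Suc w" using less by (cases "P (Suc u)") auto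
  have w_le: "P u \<le> w" "Suc w \<le> Suc u * n" using less w P_le[OF u] by simp_all
  \<comment> \<open>the entry of row u in the residue class of w\<close>
  obtain x where x: "u * n \<le> x" "x < Suc u * n" "x mod n = w mod n"
  proof -
    have "w mod n \<in> (\<lambda>x. x mod n) ` {u * n..<u * n + n}"
      using window_bij[of n "u * n"] n_pos by (simp add: bij_betw_def)
    then show ?thesis using that by auto
  qed
  have e: "P u \<le> step u x" "step u x < P u + n" using step_row[OF u' x(1,2)] by auto
  have em: "step u x mod n = w mod n" by (simp only: step_mod x(3))
  have e_le: "step u x \<le> w"
  proof (rule ccontr)
    assume "\<not> step u x \<le> w"
    moreover from this have "step u x = w"
      using e w_le by (intro window_inj[OF _ _ _ _ em, of "P u"]) simp_all
    ultimately show False by simp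
  qed
  have "stage u w \<le> stage u (step u x)"
    using e e_le w_le P by (intro c'.congruent_drop(1)[OF _ _ _ em[symmetric]]) simp_all
  moreover have "stage u w = stage (Suc u) w" using stage_Suc[OF u] w by simp
  moreover have "stage (Suc u) (Suc w) \<le> stage (Suc u) w + int m"
    using w_le n_pos by (intro c.climb) simp
  moreover have "row_rank x = stage u (step u x)" by (rule row_rank_row[OF u' x(1,2)])
  moreover have "row_rank (row_next x + n) = stage (Suc u) (Suc w)"
  proof -
    have r: "Suc u * n \<le> row_next x + n" "row_next x + n < Suc (Suc u) * n"
      using row_next_row[OF x(1,2)] by simp_all
    have "(row_next x + n) mod n = Suc x mod n" by simp
    also have "\<dots> = Suc (x mod n) mod n" by (simp only: mod_Suc_eq)
    also have "\<dots> = Suc w mod n" by (simp only: x(3) mod_Suc_eq)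
    finally have em': "step (Suc u) (row_next x + n) mod n = Suc w mod n" by (simp only: step_mod)
    then have "step (Suc u) (row_next x + n) = Suc w"
      using step_row[OF u r] w n_pos
      by (intro window_inj[OF _ _ _ _ em', of "P (Suc u)"]) simp_all
    then show ?thesis using row_rank_row[OF u r] by simp
  qed
  ultimately have "row_rank (row_next x + n) \<le> row_rank x + int m" by simp
  then show ?thesis using x(1,2) by blast
qed

text \<open>For \<open>u = d - 1\<close> the left side is the tie count of the sweep map and the right side
that of \<open>\<G>\<close>. The induction removes the segment with index \<open>u\<close>; the
three positions of \<open>z\<close> relative to it are the three cases of the proof.\<close>

lemma ties_by_row:
  assumes "u < d" "z < Suc u * n"
  shows "(\<Sum>x = Suc (move u z)..<Suc u * n. tie_change n m (row_rank z) (stage u x))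
       = (\<Sum>x = Suc (z div n) * n..<Suc u * n. tie_change n m (row_rank z) (row_rank x))"
  using assms
proof (induction u)
  case 0
  interpret c: coprime_cut_walk n m 0 "stage 0" by (rule stage_locale[OF 0(1)])
  have "row_rank z = stage 0 (move 0 z)" using row_rank_stage 0 by simp
  then have "tie_change n m (row_rank z) (stage 0 x) = 0" if "x \<in> {Suc (move 0 z)..<Suc 0 * n}" for x
    using c.no_tie_after[of "move 0 z" x] that cut_stage[OF 0(1)] P_0 by simp
  then show ?case by simp
next
  case (Suc u)
  let ?v = "Suc u" and ?q = "move (Suc u) z" and ?h = "tie_change n m (row_rank z)"
  interpret c: coprime_cut_walk n m ?v "stage ?v" by (rule stage_locale[OF Suc.prems(1)])
  have P: "c.p = P ?v" using cut_stage Suc.prems(1) by simp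
  have u': "u < d" using Suc.prems(1) by simp
  have rank_q: "row_rank z = stage ?v ?q" using row_rank_stage Suc.prems by simp
  have q_less: "?q < Suc ?v * n" by (rule move_less[OF Suc.prems])
  show ?case
  proof (cases "z < ?v * n")
    case False
    then have z: "?v * n \<le> z" by simp
    have "z div n = ?v" using row_div[OF z Suc.prems(2)] .
    moreover have "P ?v \<le> ?q" using step_row[OF Suc.prems(1) z Suc.prems(2)] move_row[OF z] by simp
    then have "?h (stage ?v x) = 0" if "x \<in> {Suc ?q..<Suc ?v * n}" for x
      unfolding rank_q using c.no_tie_after[of ?q x] that P by simp
    ultimately show ?thesis by simp
  next
    case True
    let ?w = "move u z"
    have w_less: "?w < ?v * n" using move_less[OF u' True] .
    have q: "?q = step ?v ?w" by (rule move_Suc)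
    \<comment> \<open>the columns after \<open>z\<close>: those that survive the cut, and those in the removed segment\<close>
    have split: "{Suc ?q..<Suc ?v * n}
        = {x \<in> {..<P ?v} \<union> {P ?v + n..<Suc ?v * n}. ?q < x} \<union> {x \<in> {P ?v..<P ?v + n}. ?q < x}"
      using P_le[OF Suc.prems(1)] by auto
    have bij: "bij_betw (step ?v) {Suc ?w..<?v * n}
        {x \<in> {..<P ?v} \<union> {P ?v + n..<Suc ?v * n}. ?q < x}"
    proof -
      have mono: "?q < step ?v x \<longleftrightarrow> ?w < x" if "x < ?v * n" for x
        unfolding q step_low[OF Suc.prems(1) that] step_low[OF Suc.prems(1) w_less] by auto
      have im: "step ?v ` {..<?v * n} = {..<P ?v} \<union> {P ?v + n..<Suc ?v * n}"
        and inj: "inj_on (step ?v) {..<?v * n}"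
        using step_bij_low[OF Suc.prems(1)] by (auto simp: bij_betw_def)
      show ?thesis
      proof (rule bij_betw_imageI)
        show "inj_on (step ?v) {Suc ?w..<?v * n}" by (rule inj_on_subset[OF inj]) auto
        show "step ?v ` {Suc ?w..<?v * n} = {x \<in> {..<P ?v} \<union> {P ?v + n..<Suc ?v * n}. ?q < x}"
          unfolding im[symmetric] using mono by force
      qed
    qed
    have "(\<Sum>x = Suc ?q..<Suc ?v * n. ?h (stage ?v x))
        = (\<Sum>x\<in>{x \<in> {..<P ?v} \<union> {P ?v + n..<Suc ?v * n}. ?q < x}. ?h (stage ?v x))
        + (\<Sum>x\<in>{x \<in> {P ?v..<P ?v + n}. ?q < x}. ?h (stage ?v x))"
      unfolding split by (rule sum.union_disjoint) auto
    also have "(\<Sum>x\<in>{x \<in> {..<P ?v} \<union> {P ?v + n..<Suc ?v * n}. ?q < x}. ?h (stage ?v x))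
        = (\<Sum>x = Suc ?w..<?v * n. ?h (stage ?v (step ?v x)))"
      by (rule sum.reindex_bij_betw[OF bij, symmetric])
    also have "\<dots> = (\<Sum>x = Suc ?w..<?v * n. ?h (stage u x))"
      using stage_step[OF Suc.prems(1)] by (intro sum.cong) simp_all
    also have "\<dots> = (\<Sum>x = Suc (z div n) * n..<?v * n. ?h (row_rank x))"
      by (rule Suc.IH[OF u' True])
    also have "(\<Sum>x\<in>{x \<in> {P ?v..<P ?v + n}. ?q < x}. ?h (stage ?v x))
        = (\<Sum>x = P ?v..<P ?v + n. ?h (stage ?v x))"
    proof (cases "?q < P ?v")
      case True
      then have "{x \<in> {P ?v..<P ?v + n}. ?q < x} = {P ?v..<P ?v + n}" by auto
      then show ?thesis by simp
    next
      case False
      have late: "P ?v + n \<le> ?q" using False q step_low[OF Suc.prems(1) w_less] by (auto split: if_splits)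
      then have "{x \<in> {P ?v..<P ?v + n}. ?q < x} = {}" by auto
      moreover have "(\<Sum>x = P ?v..<P ?v + n. ?h (stage ?v x)) = 0"
        unfolding rank_q using c.segment_ties_cancel[of ?q] late q_less P by simp
      ultimately show ?thesis by (simp only: sum.empty)
    qed
    also have "\<dots> = (\<Sum>x = ?v * n..<Suc ?v * n. ?h (stage ?v (step ?v x)))"
      by (rule sum.reindex_bij_betw[OF step_bij_row[OF Suc.prems(1)], symmetric])
    also have "\<dots> = (\<Sum>x = ?v * n..<Suc ?v * n. ?h (row_rank x))"
      using row_rank_row[OF Suc.prems(1)] by (intro sum.cong) simp_all
    also have "(\<Sum>x = Suc (z div n) * n..<?v * n. ?h (row_rank x)) + (\<Sum>x = ?v * n..<Suc ?v * n. ?h (row_rank x))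
        = (\<Sum>x = Suc (z div n) * n..<Suc ?v * n. ?h (row_rank x))"
    proof (rule sum.atLeastLessThan_concat)
      have "z div n < ?v" using True by (simp add: less_mult_imp_div_less)
      then show "Suc (z div n) * n \<le> ?v * n" by (intro mult_le_mono1) simp
    qed simp
    finally show ?thesis .
  qed
qed

end

section \<open>The sweep map and the map G, column by column\<close>

context dyck
begin

lemma rank_Suc: "int m * int x - int n * height d n m y (Suc x) = rank (Suc x) - int m"
  by (simp add: rk_def algebra_simps)

text \<open>The rank at the lower end of a run of steps is \<open>r x\<close> and at its upper end \<open>r (x
+ 1) - m\<close>, because the abscissa is still \<open>x\<close> there.\<close>

lemma path_column_card:
  assumes "x < d * n"
  shows "int (card {v. height d n m y x < v \<and> v \<le> height d n m y (Suc x) \<and> t \<le> rk n m x v})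
    = reach n t (rank x) - reach n t (rank (Suc x) - int m)"
  using column_card[OF n_pos path_bounds(3)[OF assms], of t "int m * int x"] rank_Suc[of x]
  by (simp add: rk_def)

lemma path_column_ties:
  assumes "x < d * n"
  shows "int (card {v. height d n m y x < v \<and> v \<le> height d n m y (Suc x) \<and> rk n m x v = t})
    = tie n t (rank x) - tie n t (rank (Suc x) - int m)"
proof -
  let ?C = "\<lambda>s. {v. height d n m y x < v \<and> v \<le> height d n m y (Suc x) \<and> s \<le> rk n m x v}"
  have "{v. height d n m y x < v \<and> v \<le> height d n m y (Suc x) \<and> rk n m x v = t} = ?C t - ?C (t + 1)"
    by auto
  moreover have "card (?C t - ?C (t + 1)) = card (?C t) - card (?C (t + 1))"
    by (intro card_Diff_subset finite_column) auto
  moreover have "card (?C (t + 1)) \<le> card (?C t)"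
    by (intro card_mono finite_column) auto
  ultimately show ?thesis
    using path_column_card[OF assms, of t] path_column_card[OF assms, of "t + 1"]
    by (simp add: tie_eq_reach[OF n_pos])
qed

lemma zeta_at_columns:
  assumes "p < d * n"
  shows "int (zeta_at d n m y (p, y ! p)) =
      (\<Sum>x<d * n. reach n (rank p + 1) (rank x) - reach n (rank p + 1) (rank (Suc x) - int m))
    + (\<Sum>x = p..<d * n. tie n (rank p) (rank x) - tie n (rank p) (rank (Suc x) - int m))"
proof -
  let ?t = "rk n m p (y ! p)"
  have t: "?t = rank p" using assms by (simp add: height_inside)
  let ?Q = "\<lambda>x v. height d n m y x < v \<and> v \<le> height d n m y (Suc x) \<and> ?t + 1 \<le> rk n m x v"
  let ?R = "\<lambda>x v. height d n m y x < v \<and> v \<le> height d n m y (Suc x) \<and> rk n m x v = ?t"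
  have "{(x, v). x < d * n \<and> height d n m y x < v \<and> v \<le> height d n m y (x + 1) \<and> rk n m x v > ?t}
      = {(x, v). x \<in> {..<d * n} \<and> ?Q x v}" by auto
  then have 1: "int (card {(x, v). x < d * n \<and> height d n m y x < v \<and> v \<le> height d n m y (x + 1)
      \<and> rk n m x v > ?t}) = (\<Sum>x<d * n. int (card {v. ?Q x v}))"
    using card_columns[of "{..<d * n}" ?Q] finite_column by simp
  have "{(x, v). p \<le> x \<and> x < d * n \<and> height d n m y x < v \<and> v \<le> height d n m y (x + 1) \<and> rk n m x v = ?t}
      = {(x, v). x \<in> {p..<d * n} \<and> ?R x v}" by auto
  then have 2: "int (card {(x, v). p \<le> x \<and> x < d * n \<and> height d n m y x < v \<and> v \<le> height d n m y (x + 1)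
      \<and> rk n m x v = ?t}) = (\<Sum>x = p..<d * n. int (card {v. ?R x v}))"
    using card_columns[of "{p..<d * n}" ?R] finite_column by simp
  have "int (zeta_at d n m y (p, y ! p))
      = (\<Sum>x<d * n. int (card {v. ?Q x v})) + (\<Sum>x = p..<d * n. int (card {v. ?R x v}))"
    unfolding zeta_at_def split by (simp only: of_nat_add 1 2)
  also have "(\<Sum>x<d * n. int (card {v. ?Q x v})) =
      (\<Sum>x<d * n. reach n (?t + 1) (rank x) - reach n (?t + 1) (rank (Suc x) - int m))"
    by (intro sum.cong refl path_column_card) simp
  also have "(\<Sum>x = p..<d * n. int (card {v. ?R x v})) =
      (\<Sum>x = p..<d * n. tie n ?t (rank x) - tie n ?t (rank (Suc x) - int m))"
    by (intro sum.cong refl path_column_ties) simp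
  finally show ?thesis unfolding t .
qed

lemma sum_shift_rank:
  fixes f :: "int \<Rightarrow> int"
  assumes "p \<le> d * n"
  shows "(\<Sum>x = p..<d * n. f (rank (Suc x))) = (\<Sum>x = p..<d * n. f (rank x)) + f 0 - f (rank p)"
  using assms
proof (induction rule: inc_induct)
  case base then show ?case by (simp add: rank_end)
next
  case (step p)
  then show ?case by (simp add: sum.atLeast_Suc_lessThan[of p])
qed

lemma sum_shift_rank_all:
  fixes f :: "int \<Rightarrow> int"
  shows "(\<Sum>x<d * n. f (rank (Suc x))) = (\<Sum>x<d * n. f (rank x))"
  using sum_shift_rank[of 0 f] by (simp add: rank_0 atLeast0LessThan)

text \<open>The chain of columns closes up since \<open>r 0 = r (dn) = 0\<close>, so a count over all columns
involves each rank together with the same rank lowered by \<open>m\<close>.\<close>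

lemma zeta_at_eq:
  assumes "p < d * n"
  shows "int (zeta_at d n m y (p, y ! p)) =
      (\<Sum>x<d * n. reach n (rank p + 1) (rank x) - reach n (rank p + 1) (rank x - int m))
    + (\<Sum>x = Suc p..<d * n. tie_change n m (rank p) (rank x))"
proof -
  let ?t = "rank p"
  have "(\<Sum>x = p..<d * n. tie n ?t (rank (Suc x) - int m))
      = (\<Sum>x = p..<d * n. tie n ?t (rank x - int m)) + tie n ?t (0 - int m) - tie n ?t (?t - int m)"
    using sum_shift_rank[of p "\<lambda>a. tie n ?t (a - int m)"] assms by simp
  also have "tie n ?t (0 - int m) = 0"
    using rank_nonneg[of p] assms by (simp add: tie_def)
  finally have "(\<Sum>x = p..<d * n. tie n ?t (rank x) - tie n ?t (rank (Suc x) - int m))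
      = (\<Sum>x = p..<d * n. tie_change n m ?t (rank x)) + tie n ?t (?t - int m)"
    by (simp add: sum_subtractf tie_change_def)
  also have "\<dots> = (\<Sum>x = Suc p..<d * n. tie_change n m ?t (rank x))"
    using assms by (simp add: sum.atLeast_Suc_lessThan[of p] tie_change_def tie_def)
  finally show ?thesis
    using sum_shift_rank_all[of "\<lambda>a. reach n (?t + 1) (a - int m)"]
    by (simp add: zeta_at_columns[OF assms] sum_subtractf)
qed

abbreviation c :: "int list" where "c \<equiv> Psi_coords d n m y"

lemma length_c: "length c = d * n"
  by (simp add: Psi_coords_def)

lemma sigma_eq: "sigma x = s_perm d n m y (x mod n) (x div n) * n + x mod n"
  by (simp add: sigma_def move_def s_perm_def)

lemma sigma_div: "sigma x div n = s_perm d n m y (x mod n) (x div n)"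
  unfolding sigma_eq using n_pos by simp

lemma c_nth:
  assumes "x < d * n"
  shows "c ! x = y ! sigma x - (int (sigma x div n) - int (x div n)) * int m"
  using assms unfolding sigma_div by (simp add: Psi_coords_def Let_def sigma_eq)

lemma int_div_mod: "int x = int n * int (x div n) + int (x mod n)"
  by (metis mult_div_mod_eq of_nat_add of_nat_mult)

text \<open>The correction \<open>(s\<^sub>j i - i) m\<close> in \<open>\<Psi>\<^sub>d\<close> is what an
entry needs in order to keep its rank when it moves from row \<open>s\<^sub>j i\<close> to row
\<open>i\<close>.\<close>

lemma rank_c:
  assumes "x < d * n"
  shows "int m * int x - int n * c ! x = row_rank x"
  unfolding row_rank_def rk_def c_nth[OF assms] int_div_mod[of x] int_div_mod[of "sigma x"] sigma_mod
  by (simp add: algebra_simps)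

lemma row_next_less: assumes "x < d * n" shows "row_next x < d * n"
proof -
  have "x div n < d" using assms by (simp add: less_mult_imp_div_less)
  then have "Suc (x div n) * n \<le> d * n" by (intro mult_le_mono1) simp
  moreover have "row_next x < Suc (x div n) * n" using n_pos by simp
  ultimately show ?thesis by simp
qed

lemma in_row: "x div n * n \<le> x" "x < Suc (x div n) * n" 
  using n_pos by (simp_all add: dividend_less_div_times add.commute)

lemma row_next_climb: "x < d * n \<Longrightarrow> row_rank (row_next x) \<le> row_rank x + int m"
  using row_climb[of "x div n" x] in_row by (simp add: less_mult_imp_div_less)

lemma c_ext_here: "c_ext n m c (x div n) (x mod n) = c ! x"
proof -
  have "x mod n \<noteq> n" using n_pos by (metis mod_less_divisor less_irrefl less_eq_Suc_le One_nat_def)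
  then show ?thesis by (simp add: c_ext_def)
qed

lemma rank_c_ext:
  assumes "x < d * n"
  shows "int m * int x - int n * c_ext n m c (x div n) (x mod n + 1) = row_rank (row_next x) - int m"
proof (cases "x mod n + 1 = n")
  case True
  then have r: "row_next x = x div n * n" by (simp add: mod_Suc)
  have "int x + 1 = int (x div n * n) + int n"
    using int_div_mod[of x] True by (simp add: algebra_simps)
  then have "int m * int x + int m = int m * int (x div n * n) + int n * int m"
    by (metis distrib_left mult.commute mult.right_neutral)
  then show ?thesis
    using rank_c[OF row_next_less[OF assms]] True unfolding r by (simp add: c_ext_def algebra_simps)
next
  case False
  then have "Suc x mod n = Suc (x mod n)" by (simp add: mod_Suc)
  then have r: "row_next x = Suc x" by simp
  moreover have "c_ext n m c (x div n) (x mod n + 1) = c ! Suc x"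
    using False by (simp add: c_ext_def)
  ultimately show ?thesis
    using rank_c[OF row_next_less[OF assms]] by (simp add: algebra_simps)
qed

lemma c_ext_mono:
  assumes "x < d * n"
  shows "c ! x \<le> c_ext n m c (x div n) (x mod n + 1)"
proof -
  have "int n * c ! x \<le> int n * c_ext n m c (x div n) (x mod n + 1)"
    using row_next_climb[OF assms] rank_c_ext[OF assms] rank_c[OF assms] by simp
  then show ?thesis using n_pos by simp
qed

lemma row_next_div: "row_next x div n = x div n"
  using n_pos by simp

lemma row_next_bij: "bij_betw row_next {..<d * n} {..<d * n}"
proof -
  have "inj_on row_next {..<d * n}"
  proof (rule inj_onI)
    fix a b assume eq: "row_next a = row_next b"
    then have q: "a div n = b div n" by (metis row_next_div)
    with eq have "Suc a mod n = Suc b mod n" by simp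
    then have "int n dvd int (Suc a) - int (Suc b)"
      by (metis mod_eq_dvd_iff of_nat_mod)
    then have "int n dvd int a - int b" by simp
    then have "a mod n = b mod n" by (metis mod_eq_dvd_iff of_nat_eq_iff of_nat_mod)
    with q show "a = b" by (metis div_mult_mod_eq)
  qed
  moreover have "row_next ` {..<d * n} \<subseteq> {..<d * n}" using row_next_less by blast
  ultimately show ?thesis by (simp add: bij_betw_def endo_inj_surj)
qed

text \<open>The element of the base of \<open>\<Delta>\<close> at position \<open>x\<close>, expressed by a
rank instead of by \<open>c\<^sub>x\<close>.\<close>

definition alpha :: "nat \<Rightarrow> int" where
  "alpha x = int d * row_rank x + int (x div n)"

text \<open>Each row is a closed chain of columns, by the convention \<open>c\<^sub>i\<^sub>n =
c\<^sub>i\<^sub>0 + m\<close>.\<close>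

lemma G_at_columns:
  assumes "p < d * n"
  shows "int (G_at d n m c (p, c ! p)) =
      (\<Sum>x<d * n. reach (d * n) (alpha p + 1) (alpha x))
    - (\<Sum>x<d * n. reach (d * n) (alpha p + 1) (alpha x - int (d * m)))"
proof -
  let ?E = "\<lambda>x. c_ext n m c (x div n) (x mod n + 1)"
  let ?e = "\<lambda>x. int d * (int m * int x) + int (x div n)"
  let ?Q = "\<lambda>x v. c ! x < v \<and> v \<le> ?E x \<and> alpha p + 1 \<le> ?e x - int (d * n) * v"
  let ?R = "reach (d * n) (alpha p + 1)"
  have N: "d * n \<ge> 1" using d_pos n_pos by simp
  have rk: "rk_hat d n m x v = ?e x - int (d * n) * v" for x v
    by (simp add: rk_hat_def algebra_simps)
  have top: "?e x - int (d * n) * c ! x = alpha x" if "x < d * n" for x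
    unfolding alpha_def rank_c[OF that, symmetric] by (simp add: algebra_simps)
  have bottom: "?e x - int (d * n) * ?E x = alpha (row_next x) - int (d * m)" if "x < d * n" for x
  proof -
    have "?e x - int (d * n) * ?E x = int d * (int m * int x - int n * ?E x) + int (x div n)"
      by (simp add: algebra_simps)
    also have "\<dots> = alpha (row_next x) - int (d * m)"
      unfolding rank_c_ext[OF that] alpha_def row_next_div by (simp add: algebra_simps)
    finally show ?thesis .
  qed
  have "rk_hat d n m p (c ! p) = alpha p" by (simp only: rk top[OF assms])
  then have "{(x, v). x < d * n \<and> c_ext n m c (x div n) (x mod n) < v \<and>
           v \<le> c_ext n m c (x div n) (x mod n + 1) \<and> rk_hat d n m x v > rk_hat d n m p (c ! p)}
      = {(x, v). x \<in> {..<d * n} \<and> ?Q x v}"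
    unfolding rk[of "_ :: nat"] c_ext_here by auto
  then have "int (G_at d n m c (p, c ! p)) = (\<Sum>x<d * n. int (card {v. ?Q x v}))"
    unfolding G_at_def split using card_columns[of "{..<d * n}" ?Q] finite_column by simp
  also have "\<dots> = (\<Sum>x<d * n. ?R (alpha x) - ?R (alpha (row_next x) - int (d * m)))"
  proof (intro sum.cong refl)
    fix x assume "x \<in> {..<d * n}"
    then have x: "x < d * n" by simp
    show "int (card {v. ?Q x v}) = ?R (alpha x) - ?R (alpha (row_next x) - int (d * m))"
      using column_card[OF N c_ext_mono[OF x], of "alpha p + 1" "?e x"]
      unfolding top[OF x] bottom[OF x] .
  qed
  also have "\<dots> = (\<Sum>x<d * n. ?R (alpha x)) - (\<Sum>x<d * n. ?R (alpha x - int (d * m)))"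
    unfolding sum_subtractf
    using sum.reindex_bij_betw[OF row_next_bij, of "\<lambda>x. ?R (alpha x - int (d * m))"] by simp
  finally show ?thesis .
qed

lemma G_at_eq:
  assumes "p < d * n"
  shows "int (G_at d n m c (p, c ! p)) =
      (\<Sum>x<d * n. reach n (row_rank p + 1) (row_rank x) - reach n (row_rank p + 1) (row_rank x - int m))
    + (\<Sum>x = Suc (p div n) * n..<d * n. tie_change n m (row_rank p) (row_rank x))"
proof -
  let ?t = "row_rank p" and ?k = "p div n"
  let ?s = "\<lambda>x. ?t + (if ?k < x div n then 0 else 1)"
  let ?R = "reach (d * n) (alpha p + 1)"
  have k: "?k < d" using assms by (simp add: less_mult_imp_div_less)
  have R: "?R (alpha x) = reach n (?s x) (row_rank x)"
    "?R (alpha x - int (d * m)) = reach n (?s x) (row_rank x - int m)" if "x < d * n" for x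
  proof -
    have i: "x div n < d" using that by (simp add: less_mult_imp_div_less)
    show "?R (alpha x) = reach n (?s x) (row_rank x)"
      unfolding alpha_def by (rule reach_lex[OF i k])
    have "alpha x - int (d * m) = int d * (row_rank x - int m) + int (x div n)"
      by (simp add: alpha_def algebra_simps)
    then show "?R (alpha x - int (d * m)) = reach n (?s x) (row_rank x - int m)"
      using reach_lex[OF i k] by (simp only: alpha_def)
  qed
  have "int (G_at d n m c (p, c ! p))
      = (\<Sum>x<d * n. reach n (?s x) (row_rank x) - reach n (?s x) (row_rank x - int m))"
    unfolding G_at_columns[OF assms] sum_subtractf[symmetric]
    by (intro sum.cong refl) (simp add: R del: of_nat_mult)
  also have "\<dots> = (\<Sum>x<d * n. (reach n (?t + 1) (row_rank x) - reach n (?t + 1) (row_rank x - int m))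
      + (if ?k < x div n then tie_change n m ?t (row_rank x) else 0))"
    by (intro sum.cong refl) (simp add: tie_change_def tie_eq_reach[OF n_pos])
  also have "\<dots> = (\<Sum>x<d * n. reach n (?t + 1) (row_rank x) - reach n (?t + 1) (row_rank x - int m))
      + (\<Sum>x<d * n. if ?k < x div n then tie_change n m ?t (row_rank x) else 0)"
    by (rule sum.distrib)
  also have "(\<Sum>x<d * n. if ?k < x div n then tie_change n m ?t (row_rank x) else 0)
      = (\<Sum>x = Suc ?k * n..<d * n. tie_change n m ?t (row_rank x))"
  proof -
    have *: "?k < x div n \<longleftrightarrow> Suc ?k * n \<le> x" for x
      using less_eq_div_iff_mult_less_eq[of n "Suc ?k" x] n_pos by (simp add: Suc_le_eq)
    have "{x \<in> {..<d * n}. Suc ?k * n \<le> x} = {Suc ?k * n..<d * n}" by auto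
    then have "{x \<in> {..<d * n}. ?k < x div n} = {Suc ?k * n..<d * n}" by (simp only: *)
    then show ?thesis by (simp add: sum.inter_filter[symmetric])
  qed
  finally show ?thesis .
qed

lemma G_at_eq_zeta_at:
  assumes "p < d * n"
  shows "G_at d n m c (p, c ! p) = zeta_at d n m y (sigma p, y ! sigma p)"
proof -
  have s: "sigma x < d * n" if "x < d * n" for x
    using sigma_bij that by (auto simp: bij_betw_def)
  have row_rank: "row_rank x = rank (sigma x)" if "x < d * n" for x
    using s[OF that] by (simp add: row_rank_def height_inside)
  have d: "Suc (d - 1) = d" using d_pos by simp
  have "(\<Sum>x = Suc (sigma p)..<d * n. tie_change n m (row_rank p) (stage (d - 1) x))
      = (\<Sum>x = Suc (p div n) * n..<d * n. tie_change n m (row_rank p) (row_rank x))"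
    using ties_by_row[of "d - 1" p] assms d_pos unfolding d sigma_def by simp
  moreover have "(\<Sum>x = Suc (sigma p)..<d * n. tie_change n m (row_rank p) (stage (d - 1) x))
      = (\<Sum>x = Suc (sigma p)..<d * n. tie_change n m (row_rank p) (rank x))"
    unfolding stage_top by (intro sum.cong refl) (simp add: height_inside)
  moreover have "(\<Sum>x<d * n. f (row_rank x)) = (\<Sum>x<d * n. f (rank x))" for f :: "int \<Rightarrow> int"
  proof -
    have "(\<Sum>x<d * n. f (row_rank x)) = (\<Sum>x<d * n. f (rank (sigma x)))"
      by (intro sum.cong refl) (simp add: row_rank)
    then show ?thesis using sum.reindex_bij_betw[OF sigma_bij, of "\<lambda>x. f (rank x)"] by simp
  qed
  ultimately have "int (G_at d n m c (p, c ! p)) = int (zeta_at d n m y (sigma p, y ! sigma p))"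
    unfolding G_at_eq[OF assms] zeta_at_eq[OF s[OF assms]] row_rank[OF assms, symmetric] sum_subtractf
    by simp
  then show ?thesis by simp
qed

end

section \<open>The admissible subset of a Dyck path\<close>

context dyck
begin

text \<open>Starting from an arbitrary residue \<open>j\<close>, the climb may wrap around the end of the row.\<close>

lemma row_climb_many:
  assumes "u < d"
  shows "row_rank (u * n + (j + k) mod n) \<le> row_rank (u * n + j mod n) + int k * int m"
proof (induction k)
  case (Suc k)
  let ?x = "u * n + (j + k) mod n"
  have x: "u * n \<le> ?x" "?x < Suc u * n" using n_pos by auto
  have "Suc ?x mod n = (j + Suc k) mod n"
  proof -
    have "Suc ?x mod n = (u * n + Suc ((j + k) mod n)) mod n" by simp
    also have "\<dots> = Suc ((j + k) mod n) mod n" by simp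
    also have "\<dots> = Suc (j + k) mod n" by (rule mod_Suc_eq)
    finally show ?thesis by simp
  qed
  then have "row_next ?x = u * n + (j + Suc k) mod n" using row_div[OF x] by simp
  then have "row_rank (u * n + (j + Suc k) mod n) \<le> row_rank ?x + int m" using row_climb[OF assms x] by simp
  then show ?case using Suc by (simp add: algebra_simps)
qed simp

text \<open>Go from \<open>x\<close> along row \<open>u\<close> to the linking position, cross to row \<open>u
+ 1\<close>, and go on along that row to \<open>x + n\<close>. This is once around the cycle of
length \<open>n\<close>, at a cost of at most \<open>m\<close> for each of the \<open>n\<close>
steps.\<close>

lemma row_rank_col:
  assumes "x + n < d * n"
  shows "row_rank (x + n) \<le> row_rank x + int m * int n"
proof -
  define u where "u = x div n"
  define j where "j = x mod n"
  have xe: "x = u * n + j" by (simp add: u_def j_def)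
  have jn: "j < n" using n_pos by (simp add: j_def)
  have u: "Suc u < d"
  proof -
    have "Suc u * n < d * n" using assms xe by simp
    then show ?thesis by (simp only: mult_less_cancel2)
  qed
  obtain x0 where x0: "u * n \<le> x0" "x0 < Suc u * n" "row_rank (row_next x0 + n) \<le> row_rank x0 + int m"
    using row_link[OF u] by blast
  define i where "i = x0 mod n"
  have x0e: "x0 = u * n + i"
    using row_div[OF x0(1,2)] div_mult_mod_eq[of x0 n] by (simp add: i_def)
  have i_n: "i < n" using n_pos by (simp add: i_def)
  \<comment> \<open>\<open>a\<close> steps lead from residue \<open>i + 1\<close> to \<open>j\<close>, and \<open>n - 1 - a\<close> further ones from \<open>j\<close> to \<open>i\<close>\<close>
  define a where "a = (j + (n - Suc i)) mod n"
  have a_n: "a < n" using n_pos by (simp add: a_def)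
  have a: "(Suc i + a) mod n = j"
  proof -
    have "(Suc i + a) mod n = (Suc i + (j + (n - Suc i))) mod n"
      unfolding a_def by (rule mod_add_right_eq)
    also have "Suc i + (j + (n - Suc i)) = j + n" using i_n by simp
    finally show ?thesis using jn by simp
  qed
  have b: "(j + (n - 1 - a)) mod n = i"
  proof -
    have "(j + (n - 1 - a)) mod n = (Suc i + a + (n - 1 - a)) mod n"
      unfolding a[symmetric] by (rule mod_add_left_eq)
    also have "Suc i + a + (n - 1 - a) = i + n" using a_n by simp
    finally show ?thesis using i_n by simp
  qed
  have r: "row_next x0 = u * n + Suc i mod n"
    unfolding i_def by (simp only: row_div[OF x0(1,2)] mod_Suc_eq)
  have "row_rank (Suc u * n + (Suc i + a) mod n) \<le> row_rank (Suc u * n + Suc i mod n) + int a * int m"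
    by (rule row_climb_many[OF u])
  moreover have "Suc u * n + (Suc i + a) mod n = x + n" unfolding a using xe by simp
  moreover have "Suc u * n + Suc i mod n = row_next x0 + n" unfolding r by simp
  ultimately have 1: "row_rank (x + n) \<le> row_rank (row_next x0 + n) + int a * int m" by (simp only:)
  have "row_rank (u * n + (j + (n - 1 - a)) mod n) \<le> row_rank (u * n + j mod n) + int (n - 1 - a) * int m"
    using u by (intro row_climb_many) simp
  then have 2: "row_rank x0 \<le> row_rank x + int (n - 1 - a) * int m"
    unfolding b using xe x0e jn by simp
  have "int a * int m + int m + int (n - 1 - a) * int m = (int a + 1 + int (n - 1 - a)) * int m"
    by (simp add: algebra_simps)
  also have "int a + 1 + int (n - 1 - a) = int n" using a_n by simp
  finally show ?thesis using 1 2 x0(3) by (simp add: mult.commute)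
qed

lemma row_rank_residue: assumes "x < d * n" shows "int n dvd row_rank x - int m * int x"
proof -
  have "row_rank x - int m * int x = int n * (- c ! x)" using rank_c[OF assms, symmetric] by simp
  then show ?thesis by (simp only: dvd_triv_left)
qed

lemma row_rank_zero: "row_rank 0 = 0"
proof -
  have "row_rank 0 = stage 0 (step 0 0)" using row_rank_row[of 0 0] d_pos n_pos by simp
  then show ?thesis using cut_walk.start[OF coprime_cut_walk.axioms(1)[OF stage_locale[of 0]]] d_pos
    by (simp add: step_0)
qed

sublocale stair: staircase d n m row_rank
  using d_pos n_pos coprime row_rank_zero row_rank_nonneg row_rank_residue row_next_climb row_rank_col
  by unfold_locales auto

lemma alpha_fun: "(\<lambda>x. int d * row_rank x + int (x div n)) = alpha"
  by (rule ext) (simp add: alpha_def)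

sublocale res: residue_system "d * n" alpha
  using stair.residue_system_axioms unfolding alpha_fun .

lemma stair_gen: "stair.gen = res.gen"
  unfolding alpha_fun ..

lemma a_hat_c: "x < d * n \<Longrightarrow> int (a_hat d n m x) - int (d * n) * c ! x = alpha x"
  by (simp add: int_a_hat[OF n_pos] alpha_def rank_c[symmetric] algebra_simps)

lemma Psi_eq: "Psi d n m y = res.gen"
proof -
  have "(\<exists>x<d * n. \<exists>k::nat. int b = int (a_hat d n m x) - int (d * n) * c ! x + int (d * n) * int k)
      \<longleftrightarrow> (\<exists>x<d * n. \<exists>k::nat. int b = alpha x + int (d * n) * int k)" for b
    using a_hat_c by (metis (no_types, lifting))
  then show ?thesis unfolding Psi_def subset_of_def res.gen_def by (simp only:)
qed

lemma base_Psi: "base d n (Psi d n m y) = (\<lambda>x. nat (alpha x)) ` {..<d * n}"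
  unfolding Psi_eq by (rule res.base_gen[OF refl])

lemma alpha_nonneg: "x < d * n \<Longrightarrow> 0 \<le> alpha x"
  by (rule res.A_nonneg)

lemma c_bounds:
  assumes "x < d * n"
  shows "0 \<le> c ! x" "c ! x \<le> int (a_bound n m x)"
proof -
  have n: "0 < int n" using n_pos by simp
  have "0 \<le> int n * c ! x" using stair.h_le[OF assms] rank_c[OF assms] by simp
  then show "0 \<le> c ! x" using n by (simp add: zero_le_mult_iff)
  have "int n * c ! x \<le> int (m * x)" using row_rank_nonneg[OF assms] rank_c[OF assms] by simp
  then have "c ! x \<le> int (m * x) div int n" using le_div_iff_mult_le_int[OF n_pos] by simp
  then show "c ! x \<le> int (a_bound n m x)" unfolding a_bound_eq by (simp add: zdiv_int)
qed

lemma corresponds_Psi: "corresponds d n m (Psi d n m y) c"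
  unfolding corresponds_def
proof (intro conjI allI impI)
  show "length c = d * n" by (rule length_c)
  show "0 \<le> c ! x" "c ! x \<le> int (a_bound n m x)" if "x < d * n" for x using c_bounds[OF that] .
  have "int ` base d n (Psi d n m y) = (\<lambda>x. int (nat (alpha x))) ` {..<d * n}"
    unfolding base_Psi by (simp add: image_image)
  also have "\<dots> = (\<lambda>x. int (a_hat d n m x) - int (d * n) * c ! x) ` {..<d * n}"
    by (intro image_cong refl) (simp add: alpha_nonneg a_hat_c del: of_nat_mult)
  finally show "int ` base d n (Psi d n m y)
      = {int (a_hat d n m x) - int (d * n) * c ! x | x. x < d * n}" by auto
qed

text \<open>For \<open>i < d - 1\<close> the required element is the linking position of rows \<open>i\<close>
and \<open>i + 1\<close>. In the last row it is the entry with \<open>m (j + 1) + 1\<close>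
divisible by \<open>n\<close>, for which adding \<open>dm + 1\<close> leads into the class of
\<open>0\<close>.\<close>

lemma Psi_Adm: "Psi d n m y \<in> Adm d n m"
proof -
  have "\<exists>a\<in>base d n (Psi d n m y). a mod d = i \<and> a + d * m + 1 \<in> Psi d n m y" if i: "i < d" for i
  proof -
    have *: ?thesis if x: "i * n \<le> x" "x < Suc i * n" and x': "x' < d * n"
      "int (d * n) dvd alpha x + int (d * m) + 1 - alpha x'" "alpha x' \<le> alpha x + int (d * m) + 1" for x x'
    proof -
      have "Suc i * n \<le> d * n" using i by (intro mult_le_mono1) simp
      then have xN: "x < d * n" using x(2) by simp
      have al: "int (nat (alpha x)) = int d * row_rank x + int i"
        using alpha_nonneg[OF xN] row_div[OF x] by (simp add: alpha_def)
      have "int (nat (alpha x) mod d) = (int d * row_rank x + int i) mod int d"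
        unfolding zmod_int al ..
      also have "\<dots> = int i" using i by simp
      finally have "nat (alpha x) mod d = i" by simp
      moreover have "nat (alpha x) + d * m + 1 \<in> res.gen"
        using res.gen_iff[OF x'(1), of "nat (alpha x) + d * m + 1"] x'(2,3)
          alpha_nonneg[OF xN] by (simp add: algebra_simps)
      moreover have "nat (alpha x) \<in> base d n (Psi d n m y)" unfolding base_Psi using xN by simp
      ultimately show ?thesis unfolding Psi_eq by blast
    qed
    show ?thesis
    proof (cases "Suc i < d")
      case True
      obtain x where x: "i * n \<le> x" "x < Suc i * n" "row_rank (row_next x + n) \<le> row_rank x + int m"
        using row_link[OF True] by blast
      define z where "z = row_next x + n"
      have xz: "row_rank z \<le> row_rank x + int m" using x(3) by (simp only: z_def)
      have r: "Suc i * n \<le> z" "z < Suc (Suc i) * n"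
        using row_next_row[OF x(1,2)] by (simp_all add: z_def)
      have "Suc (Suc i) * n \<le> d * n" "Suc i * n \<le> d * n"
        using True by (intro mult_le_mono1; simp)+
      then have N: "x < d * n" "z < d * n" using x(2) r(2) by linarith+
      have e: "alpha x + int (d * m) + 1 - alpha z = int d * (row_rank x + int m - row_rank z)"
        unfolding alpha_def row_div[OF x(1,2)] row_div[OF r] by (simp add: algebra_simps)
      have "z mod n = Suc x mod n" by (simp add: z_def)
      then have "int n dvd int (Suc x) - int z" by (metis mod_eq_dvd_iff of_nat_mod)
      then have "int n dvd int m * (int (Suc x) - int z)" by (rule dvd_mult)
      moreover have "int m * (int (Suc x) - int z) = int m * int x + int m - int m * int z"
        by (simp add: algebra_simps)
      ultimately have "int n dvd int m * int x + int m - int m * int z" by (simp only:)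
      then have "int n dvd row_rank x + int m - row_rank z" using stair.residue_diff[OF N] by blast
      then have 1: "int (d * n) dvd alpha x + int (d * m) + 1 - alpha z" unfolding e by simp
      have "0 \<le> alpha x + int (d * m) + 1 - alpha z" unfolding e using xz by simp
      then have 2: "alpha z \<le> alpha x + int (d * m) + 1" by simp
      show ?thesis by (rule *[OF x(1,2) N(2) 1 2])
    next
      case False
      then have di: "d = Suc i" using i by simp
      obtain j where j: "j < n" "int n dvd int m * int j - (- int m - 1)"
        using residue_solution[OF n_pos coprime] by blast
      let ?x = "i * n + j"
      have x: "i * n \<le> ?x" "?x < Suc i * n" "?x < d * n" using j(1) by (simp_all add: di)
      have N0: "0 < d * n" using d_pos n_pos by simp
      have e: "alpha ?x + int (d * m) + 1 - alpha 0 = int d * (row_rank ?x + (int m + 1) - row_rank 0)"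
        unfolding alpha_def row_div[OF x(1,2)] by (simp add: di algebra_simps)
      have "int n dvd int n * (int m * int i) + (int m * int j - (- int m - 1))"
        by (intro dvd_add j(2)) simp
      then have "int n dvd int m * int ?x + (int m + 1) - int m * int 0"
        by (simp add: algebra_simps)
      then have "int n dvd row_rank ?x + (int m + 1) - row_rank 0" using stair.residue_diff[OF x(3) N0] by blast
      then have 1: "int (d * n) dvd alpha ?x + int (d * m) + 1 - alpha 0" unfolding e by simp
      have "0 \<le> alpha ?x + int (d * m) + 1 - alpha 0"
        unfolding e using row_rank_nonneg[OF x(3)] row_rank_zero by simp
      then have 2: "alpha 0 \<le> alpha ?x + int (d * m) + 1" by simp
      show ?thesis by (rule *[OF x(1,2) N0 1 2])
    qed
  qed
  then show ?thesis
    unfolding Adm_def using stair.Gam_gen[unfolded stair_gen] stair.zero_in_gen[unfolded stair_gen] by (simp add: Psi_eq)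
qed

text \<open>The correction terms \<open>(s\<^sub>j i - i) m\<close> cancel because each
\<open>s\<^sub>j\<close> is a permutation.\<close>

lemma sum_c: "sum_list c = sum_list y"
proof -
  have "sum_list c = (\<Sum>x<d * n. c ! x)"
    by (simp add: sum_list_sum_nth length_c atLeast0LessThan)
  also have "\<dots> = (\<Sum>x<d * n. y ! sigma x) - ((\<Sum>x<d * n. int (sigma x div n)) - (\<Sum>x<d * n. int (x div n))) * int m"
    by (simp add: c_nth sum_subtractf sum_distrib_right[symmetric])
  also have "(\<Sum>x<d * n. y ! sigma x) = (\<Sum>x<d * n. y ! x)"
    by (rule sum.reindex_bij_betw[OF sigma_bij])
  also have "(\<Sum>x<d * n. int (sigma x div n)) = (\<Sum>x<d * n. int (x div n))"
    by (rule sum.reindex_bij_betw[OF sigma_bij])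
  finally show ?thesis by (simp add: sum_list_sum_nth length_path atLeast0LessThan)
qed

lemma e_stat_Psi: "e_stat d n m (Psi d n m y) = sum_list c"
proof -
  have "UNIV - Psi d n m y = {b. 0 \<le> int b \<and> b \<notin> res.gen}" unfolding Psi_eq by auto
  then have "int (card (UNIV - Psi d n m y)) = (\<Sum>x<d * n. reach (d * n) 0 (alpha x))"
    using res.missing_card[of 0] by simp
  also have "\<dots> = (\<Sum>x<d * n. int (m * x) div int n - c ! x)"
  proof (intro sum.cong refl)
    fix x assume "x \<in> {..<d * n}"
    then have x: "x < d * n" by simp
    then have i: "x div n < d" by (simp add: less_mult_imp_div_less)
    have "0 \<le> row_rank x div int n" using row_rank_nonneg[OF x] by (simp add: div_int_pos_iff)
    then have "reach (d * n) 0 (alpha x) = row_rank x div int n"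
      unfolding reach_def diff_0_right alpha_def div_add_digit[OF i] by simp
    also have "\<dots> = int (m * x) div int n - c ! x"
      unfolding rank_c[OF x, symmetric] using div_shift[OF n_pos] by simp
    finally show "reach (d * n) 0 (alpha x) = int (m * x) div int n - c ! x" .
  qed
  finally show ?thesis
    using delta_eq[OF d_pos n_pos coprime]
    by (simp add: e_stat_def sum_subtractf sum_list_sum_nth length_c atLeast0LessThan)
qed

lemma sum_zeta: "sum_list (zeta d n m y) = (\<Sum>p<d * n. int (zeta_at d n m y (p, y ! p)))"
proof -
  have "sum_list (zeta d n m y) = sum_mset (mset (zeta d n m y))" by (rule sum_mset_sum_list[symmetric])
  also have "mset (zeta d n m y) = mset (map (\<lambda>p. int (zeta_at d n m y (p, y ! p))) [0..<d * n])"
    by (simp add: zeta_def)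
  also have "sum_mset \<dots> = sum_list (map (\<lambda>p. int (zeta_at d n m y (p, y ! p))) [0..<d * n])"
    by (rule sum_mset_sum_list)
  also have "\<dots> = (\<Sum>p<d * n. int (zeta_at d n m y (p, y ! p)))"
    by (simp add: interv_sum_list_conv_sum_set_nat atLeast0LessThan)
  finally show ?thesis .
qed

text \<open>Since \<open>a\<close> itself is not a gap, the count starts at \<open>a + 1\<close>, as in the
strict inequality of \<open>\<G>\<close>.\<close>

lemma Gaps_card:
  assumes "a \<in> res.gen"
  shows "int (card (Gaps res.gen a)) = (\<Sum>x<d * n. reach (d * n) (int a + 1) (alpha x))"
proof -
  have "Gaps res.gen a = {b. int a + 1 \<le> int b \<and> b \<notin> res.gen}"
  proof (intro set_eqI)
    fix b
    show "b \<in> Gaps res.gen a \<longleftrightarrow> b \<in> {b. int a + 1 \<le> int b \<and> b \<notin> res.gen}"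
      using assms by (cases "a = b") (auto simp: Gaps_def)
  qed
  then show ?thesis using res.missing_card[of "int a + 1"] by simp
qed

text \<open>Lowering the threshold by \<open>dm\<close> turns the gap count at \<open>a + dm\<close> into the
sum that is subtracted in the count for \<open>\<G>\<close>.\<close>

lemma dim_stat_Psi: "dim_stat d n m (Psi d n m y) = (\<Sum>p<d * n. int (G_at d n m c (p, c ! p)))"
proof -
  have inj: "inj_on (\<lambda>x. nat (alpha x)) {..<d * n}"
    by (rule res.inj_base)
  have "int (card (Gaps res.gen (nat (alpha p)))) - int (card (Gaps res.gen (nat (alpha p) + d * m)))
      = int (G_at d n m c (p, c ! p))" if p: "p < d * n" for p
  proof -
    have a: "nat (alpha p) \<in> res.gen" by (rule res.base_in_gen[OF p])
    have shift: "reach (d * n) (int (nat (alpha p) + d * m) + 1) b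
        = reach (d * n) (alpha p + 1) (b - int (d * m))" for b
      using alpha_nonneg[OF p] by (simp add: reach_def algebra_simps)
    have i: "int (nat (alpha p)) = alpha p" using alpha_nonneg[OF p] by simp
    show ?thesis
      unfolding Gaps_card[OF a] Gaps_card[OF stair.gen_add_dm[unfolded stair_gen, OF a]] G_at_columns[OF p] shift i ..
  qed
  then show ?thesis
    unfolding dim_stat_def base_Psi sum.reindex[OF inj] comp_def sum_subtractf[symmetric]
    unfolding Psi_eq by (intro sum.cong refl) simp
qed

lemma sum_G_eq_sum_zeta:
  "(\<Sum>p<d * n. int (G_at d n m c (p, c ! p))) = (\<Sum>p<d * n. int (zeta_at d n m y (p, y ! p)))"
proof -
  have "(\<Sum>p<d * n. int (G_at d n m c (p, c ! p)))
      = (\<Sum>p<d * n. int (zeta_at d n m y (sigma p, y ! sigma p)))"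
    by (intro sum.cong refl) (simp add: G_at_eq_zeta_at)
  also have "\<dots> = (\<Sum>p<d * n. int (zeta_at d n m y (p, y ! p)))"
    by (rule sum.reindex_bij_betw[OF sigma_bij])
  finally show ?thesis .
qed

text \<open>Both sides sort the same multiset of values, listed in an order that differs by
\<open>sigma\<close>.\<close>

lemma zeta_eq_G_map: "zeta d n m y = G_map d n m (Psi d n m y)"
proof -
  let ?z = "\<lambda>p. int (zeta_at d n m y (p, y ! p))"
  have coords: "coords d n m (Psi d n m y) = c"
    by (rule coords_eq[OF d_pos n_pos coprime corresponds_Psi])
  have im: "image_mset sigma (mset_set {0..<d * n}) = mset_set {0..<d * n}"
    using sigma_bij by (simp add: image_mset_mset_set bij_betw_def atLeast0LessThan)
  have "map (\<lambda>p. int (G_at d n m c (p, c ! p))) [0..<d * n] = map (?z \<circ> sigma) [0..<d * n]"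
    by (simp add: G_at_eq_zeta_at)
  moreover have "mset (map (?z \<circ> sigma) [0..<d * n]) = image_mset ?z (image_mset sigma (mset_set {0..<d * n}))"
    by (simp add: image_mset.compositionality)
  moreover have "\<dots> = mset (map ?z [0..<d * n])" unfolding im by simp
  ultimately show ?thesis
    unfolding G_map_def coords zeta_def Let_def
    by (intro properties_for_sort) (simp_all only: mset_sort sorted_sort)
qed

end

section \<open>The dinv statistic\<close>

context dyck
begin

lemma height_mono:
  assumes "w \<le> x" "x \<le> d * n"
  shows "height d n m y w \<le> height d n m y x"
  using assms
proof (induction rule: dec_induct)
  case (step x)
  then show ?case using path_bounds(3)[of x] by simp
qed simp

lemma height_0: "height d n m y 0 = 0"
  using rank_0 n_pos by (simp add: rk_def)

lemma row_column:
  assumes "x < d * n" "1 \<le> v" "v \<le> height d n m y x"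
  obtains w where "w < x" "height d n m y w < v" "v \<le> height d n m y (Suc w)"
proof -
  let ?l = "LEAST x. v \<le> height d n m y x"
  have l: "v \<le> height d n m y ?l" by (rule LeastI[of _ x]) (rule assms(3))
  have "?l \<le> x" by (rule Least_le) (rule assms(3))
  moreover have "?l \<noteq> 0"
  proof
    assume "?l = 0"
    then show False using l height_0 assms(2) by simp
  qed
  then obtain w where w: "?l = Suc w" by (cases ?l) auto
  have "height d n m y w < v" using not_less_Least[of w "\<lambda>x. v \<le> height d n m y x"] w by simp
  ultimately show ?thesis using that[of w] l w by (simp add: Suc_le_eq)
qed

abbreviation dinv_box :: "nat \<times> int \<Rightarrow> bool" where
  "dinv_box z \<equiv> real_of_int (leg y z) / real (arm d n y z + 1) \<le> real m / real n \<and>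
     (arm d n y z = 0 \<or> real m / real n < real_of_int (leg y z + 1) / real (arm d n y z))"

lemma arm_eq:
  assumes "w < p" "p < d * n" "height d n m y w < v" "v \<le> height d n m y (Suc w)" "1 \<le> v"
  shows "arm d n y (p, v) = p - Suc w"
proof -
  have "{z \<in> boxes d n y. snd z = snd (p, v) \<and> fst z < fst (p, v)} = (\<lambda>x. (x, v)) ` {Suc w..<p}"
  proof (intro equalityI subsetI)
    fix z assume "z \<in> {z \<in> boxes d n y. snd z = snd (p, v) \<and> fst z < fst (p, v)}"
    then obtain x where x: "z = (x, v)" "x < p" "v \<le> y ! x" "x < d * n" by (auto simp: boxes_def)
    have "\<not> x \<le> w"
    proof
      assume "x \<le> w"
      then have "height d n m y x \<le> height d n m y w" using assms by (intro height_mono) auto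
      then show False using x assms(3) by (simp add: height_inside)
    qed
    then show "z \<in> (\<lambda>x. (x, v)) ` {Suc w..<p}" using x by auto
  next
    fix z assume "z \<in> (\<lambda>x. (x, v)) ` {Suc w..<p}"
    then obtain x where x: "z = (x, v)" "Suc w \<le> x" "x < p" by auto
    have "height d n m y (Suc w) \<le> height d n m y x" using x assms by (intro height_mono) auto
    then show "z \<in> {z \<in> boxes d n y. snd z = snd (p, v) \<and> fst z < fst (p, v)}"
      using x assms by (simp add: boxes_def height_inside)
  qed
  then show ?thesis by (simp add: arm_def card_image inj_on_def)
qed

text \<open>With arm \<open>p - w - 1\<close> and leg \<open>y\<^sub>p - v\<close>, clearing denominators
turns the two slope conditions into bounds on the rank of the vertical step \<open>(w, v)\<close>
that begins the row of the box.\<close>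

lemma dinv_box_iff:
  assumes "w < p" "p < d * n" "height d n m y w < v" "v \<le> height d n m y (Suc w)" "1 \<le> v"
  shows "dinv_box (p, v) \<longleftrightarrow> rank p + 1 - int m - int n \<le> rk n m w v \<and> rk n m w v < rank p + 1"
proof -
  let ?L = "y ! p - v" and ?a = "p - Suc w"
  have arm: "arm d n y (p, v) = ?a" by (rule arm_eq[OF assms])
  have leg: "leg y (p, v) = ?L" by (simp add: leg_def)
  have a: "int ?a = int p - int w - 1" using assms(1) by (simp add: of_nat_diff)
  have rp: "rank p = int m * int p - int n * (y ! p)" using assms(2) by (simp add: rk_def height_inside)
  have "height d n m y (Suc w) \<le> height d n m y p" using assms by (intro height_mono) auto
  then have L: "0 \<le> ?L" using assms by (simp add: height_inside)
  have n: "0 < real n" using n_pos by simp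
  have "real_of_int ?L / real (?a + 1) \<le> real m / real n \<longleftrightarrow> real n * real_of_int ?L \<le> real m * real (?a + 1)"
    using n by (simp add: field_simps)
  also have "\<dots> \<longleftrightarrow> real_of_int (int n * ?L) \<le> real_of_int (int m * int (?a + 1))" by simp
  also have "\<dots> \<longleftrightarrow> int n * ?L \<le> int m * int (?a + 1)" by (simp only: of_int_le_iff)
  also have "\<dots> \<longleftrightarrow> rk n m w v < rank p + 1" unfolding rp unfolding rk_def of_nat_add a by (auto simp: algebra_simps)
  finally have 1: "real_of_int ?L / real (?a + 1) \<le> real m / real n \<longleftrightarrow> rk n m w v < rank p + 1" .
  have "?a = 0 \<or> real m / real n < real_of_int (?L + 1) / real ?a
      \<longleftrightarrow> real m * real ?a < real n * real_of_int (?L + 1)"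
  \<comment> \<open>for arm \<open>0\<close> the cleared inequality holds because the leg is nonnegative\<close>
  proof (cases "?a = 0")
    case True
    have "0 < real n * real_of_int (?L + 1)" using n L by (intro mult_pos_pos) linarith+
    then show ?thesis using True by simp
  next
    case False
    then have "0 < real ?a" by simp
    then show ?thesis using n False by (simp add: field_simps del: of_nat_diff)
  qed
  also have "\<dots> \<longleftrightarrow> real_of_int (int m * int ?a) < real_of_int (int n * (?L + 1))" by simp
  also have "\<dots> \<longleftrightarrow> int m * int ?a < int n * (?L + 1)" by (simp only: of_int_less_iff)
  also have "\<dots> \<longleftrightarrow> rank p + 1 - int m - int n \<le> rk n m w v"
    unfolding rp unfolding rk_def a by (auto simp: algebra_simps)
  finally have 2: "(?a = 0 \<or> real m / real n < real_of_int (?L + 1) / real ?a)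
      \<longleftrightarrow> rank p + 1 - int m - int n \<le> rk n m w v" .
  show ?thesis unfolding arm leg 1 2 by blast
qed

lemma dinv_columns:
  "int (dinv d n m y) = (\<Sum>p<d * n. \<Sum>w<p.
     (reach n (rank p + 1 - int m - int n) (rank w)
        - reach n (rank p + 1 - int m - int n) (rank (Suc w) - int m))
     - (reach n (rank p + 1) (rank w) - reach n (rank p + 1) (rank (Suc w) - int m)))"
proof -
  let ?H = "height d n m y"
  let ?C = "\<lambda>w t. {v. ?H w < v \<and> v \<le> ?H (Suc w) \<and> t \<le> rk n m w v}"
  let ?lo = "\<lambda>p. rank p + 1 - int m - int n"
  let ?Q = "\<lambda>p v. 1 \<le> v \<and> v \<le> y ! p \<and> dinv_box (p, v)"
  have "dinv d n m y = card {(p, v). p \<in> {..<d * n} \<and> ?Q p v}"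
    unfolding dinv_def by (rule arg_cong[of _ _ card]) (auto simp: boxes_def)
  moreover have "finite {v. ?Q p v}" for p
    by (rule finite_subset[of _ "{1..y ! p}"]) auto
  ultimately have "int (dinv d n m y) = (\<Sum>p<d * n. int (card {v. ?Q p v}))"
    using card_columns[of "{..<d * n}" ?Q] by simp
  also have "\<dots> = (\<Sum>p<d * n. \<Sum>w<p. (reach n (?lo p) (rank w) - reach n (?lo p) (rank (Suc w) - int m))
     - (reach n (rank p + 1) (rank w) - reach n (rank p + 1) (rank (Suc w) - int m)))"
  proof (intro sum.cong refl)
    fix p assume "p \<in> {..<d * n}"
    then have p: "p < d * n" by simp
    let ?W = "\<lambda>w. ?C w (?lo p) - ?C w (rank p + 1)"
    have eq: "{v. ?Q p v} = (\<Union>w<p. ?W w)"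
    proof (intro equalityI subsetI)
      fix v assume v: "v \<in> {v. ?Q p v}"
      then have v1: "1 \<le> v" "v \<le> ?H p" using p by (auto simp: height_inside)
      obtain w where w: "w < p" "?H w < v" "v \<le> ?H (Suc w)" by (rule row_column[OF p v1])
      have "?lo p \<le> rk n m w v \<and> rk n m w v < rank p + 1"
        using dinv_box_iff[OF w(1) p w(2,3) v1(1)] v by blast
      then show "v \<in> (\<Union>w<p. ?W w)" using w by auto
    next
      fix v assume "v \<in> (\<Union>w<p. ?W w)"
      then obtain w where w: "w < p" "?H w < v" "v \<le> ?H (Suc w)"
        "?lo p \<le> rk n m w v" "rk n m w v < rank p + 1" by auto
      have "?H 0 \<le> ?H w" using w p by (intro height_mono) auto
      then have v1: "1 \<le> v" using w height_0 by simp
      have "?H (Suc w) \<le> ?H p" using w p by (intro height_mono) auto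
      then have "v \<le> y ! p" using w(3) p by (simp add: height_inside)
      then show "v \<in> {v. ?Q p v}"
        using v1 dinv_box_iff[OF w(1) p w(2,3) v1] w(4,5) by blast
    qed
    have disj: "?W w \<inter> ?W w' = {}" if ww: "w < p" "w' < p" "w \<noteq> w'" for w w'
    proof -
      have no: False if "a < b" "b < p" "v \<in> ?W a" "v \<in> ?W b" for a b v
      proof -
        have "?H (Suc a) \<le> ?H b" using that p by (intro height_mono) auto
        then show False using that by auto
      qed
      show ?thesis using no[of w w'] no[of w' w] ww by (cases "w < w'") auto
    qed
    have W: "int (card (?W w)) = (reach n (?lo p) (rank w) - reach n (?lo p) (rank (Suc w) - int m))
     - (reach n (rank p + 1) (rank w) - reach n (rank p + 1) (rank (Suc w) - int m))" if "w < p" for w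
    proof -
      have w: "w < d * n" using that p by simp
      have sub: "?C w (rank p + 1) \<subseteq> ?C w (?lo p)" by auto
      have "card (?W w) = card (?C w (?lo p)) - card (?C w (rank p + 1))"
        by (rule card_Diff_subset[OF finite_column sub])
      moreover have "card (?C w (rank p + 1)) \<le> card (?C w (?lo p))"
        by (rule card_mono[OF finite_column sub])
      ultimately show ?thesis
        using path_column_card[OF w, of "?lo p"] path_column_card[OF w, of "rank p + 1"] by simp
    qed
    have fin: "finite (?W w)" for w by (rule finite_Diff) (rule finite_column)
    have "card {v. ?Q p v} = (\<Sum>w<p. card (?W w))"
      unfolding eq using fin disj by (intro card_UN_disjoint) auto
    then have "int (card {v. ?Q p v}) = (\<Sum>w<p. int (card (?W w)))" by simp
    also have "\<dots> = (\<Sum>w<p. (reach n (?lo p) (rank w) - reach n (?lo p) (rank (Suc w) - int m))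
     - (reach n (rank p + 1) (rank w) - reach n (rank p + 1) (rank (Suc w) - int m)))"
      by (intro sum.cong refl W) simp
    finally show "int (card {v. ?Q p v}) = \<dots>" .
  qed
  finally show ?thesis .
qed

text \<open>In the columns before \<open>p\<close> the steps of rank above \<open>r p\<close> counted by
\<open>\<zeta>\<close> join those counted by dinv, so that all steps of rank above \<open>r p - m
- n\<close> are counted; from \<open>p\<close> on, \<open>\<zeta>\<close> counts the steps of rank
at least \<open>r p\<close>. All boundary terms of the telescoping are counts of nothing.\<close>

lemma zeta_plus_dinv_at:
  assumes p: "p < d * n"
  shows "int (zeta_at d n m y (p, y ! p)) + (\<Sum>w<p.
     (reach n (rank p + 1 - int m - int n) (rank w)
        - reach n (rank p + 1 - int m - int n) (rank (Suc w) - int m))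
     - (reach n (rank p + 1) (rank w) - reach n (rank p + 1) (rank (Suc w) - int m)))
   = (\<Sum>w<p. reach n (rank p + 1 - int m - int n) (rank w)
        - reach n (rank p + 1 - int m - int n) (rank w - int m))
   + (\<Sum>w = Suc p..<d * n. reach n (rank p) (rank w) - reach n (rank p) (rank w - int m))"
proof -
  let ?t = "rank p"
  define F where "F = reach n (?t + 1 - int m - int n)"
  define G where "G = reach n (?t + 1)"
  define K where "K = reach n ?t"
  have t: "0 \<le> ?t" using rank_nonneg p by simp
  have n: "0 < int n" using n_pos by simp
  have neg: "reach n s a = 0" if "a < s + int n" for s a
  proof -
    have "(a - s) div int n < 1" using that n le_div_iff_mult_le_int[OF n_pos, of 1 "a - s"] by simp
    then show ?thesis by (simp add: reach_def)
  qed
  have split: "(\<Sum>x<d * n. f x) = (\<Sum>x<p. f x) + (\<Sum>x = p..<d * n. f x)" for f :: "nat \<Rightarrow> int"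
    using sum.atLeastLessThan_concat[of 0 p "d * n" f] p by (simp add: atLeast0LessThan)
  have low: "(\<Sum>w<p. F (rank (Suc w) - int m)) = (\<Sum>w<p. F (rank w - int m))"
  proof -
    have "(\<Sum>w<p. F (rank (Suc w) - int m)) + F (rank 0 - int m)
        = (\<Sum>w<p. F (rank w - int m)) + F (rank p - int m)"
      using sum.lessThan_Suc_shift[of "\<lambda>w. F (rank w - int m)" p]
        sum.lessThan_Suc[of "\<lambda>w. F (rank w - int m)" p] by simp
    moreover have "F (rank 0 - int m) = 0" "F (rank p - int m) = 0"
      unfolding F_def rank_0 using t by (auto intro!: neg)
    ultimately show ?thesis by simp
  qed
  have high: "(\<Sum>w = p..<d * n. K (rank w) - K (rank (Suc w) - int m))
      = (\<Sum>w = Suc p..<d * n. K (rank w) - K (rank w - int m))"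
  proof -
    have "(\<Sum>x = p..<d * n. K (rank (Suc x) - int m))
        = (\<Sum>x = p..<d * n. K (rank x - int m)) + K (0 - int m) - K (rank p - int m)"
      using sum_shift_rank[of p "\<lambda>a. K (a - int m)"] p by simp
    moreover have "K (0 - int m) = 0" "K (rank p - int m) = 0" "K (rank p) = 0"
      unfolding K_def using t n by (auto intro!: neg)
    ultimately show ?thesis
      using p by (simp add: sum_subtractf sum.atLeast_Suc_lessThan[of p])
  qed
  have "int (zeta_at d n m y (p, y ! p)) = (\<Sum>x<p. G (rank x) - G (rank (Suc x) - int m))
      + (\<Sum>x = p..<d * n. K (rank x) - K (rank (Suc x) - int m))"
    unfolding zeta_at_columns[OF p] split G_def[symmetric] add.assoc sum.distrib[symmetric]
    by (simp add: tie_eq_reach[OF n_pos] G_def K_def)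
  then show ?thesis
    unfolding F_def[symmetric] G_def[symmetric] K_def[symmetric] high[symmetric]
    using low by (simp add: sum_subtractf)
qed

text \<open>Pairing the term for \<open>w\<close> seen from \<open>p\<close> with the term for
\<open>p\<close> seen from \<open>w\<close> removes the positive parts, by
\<open>reach_balance\<close>; the heights enter only as multiples of \<open>n\<close>, so they
leave the quotients as integers and cancel.\<close>

lemma pair_contribution:
  assumes "w < p" "p < d * n"
  shows "reach n (rank p + 1 - int m - int n) (rank w) - reach n (rank p + 1 - int m - int n) (rank w - int m)
    + (reach n (rank w) (rank p) - reach n (rank w) (rank p - int m))
    = int (m * (p - w)) div int n - int (m * (p - Suc w)) div int n"
proof -
  let ?D = "rank p - rank w" and ?h = "y ! p - y ! w"
  have s: "rank p + 1 - int m - int n = (rank p - int m) + 1 - int n" by simp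
  have e: "reach n (rank p + 1 - int m - int n) (rank w - int m) = reach n (rank p + 1 - int n) (rank w)"
    by (simp add: reach_def algebra_simps)
  have 1: "reach n (rank p + 1 - int m - int n) (rank w) - reach n (rank w) (rank p - int m)
      = - ((?D - int m) div int n)"
    unfolding s reach_balance[OF n_pos] neg_div_round_up[OF n_pos, symmetric] by (simp add: algebra_simps)
  have 2: "reach n (rank p + 1 - int m - int n) (rank w - int m) - reach n (rank w) (rank p)
      = - (?D div int n)"
    unfolding e reach_balance[OF n_pos] neg_div_round_up[OF n_pos, symmetric] by (simp add: algebra_simps)
  have D: "?D = int (m * (p - w)) - int n * ?h"
    using assms by (simp add: rk_def height_inside of_nat_diff algebra_simps)
  have "p - w = Suc (p - Suc w)" using assms(1) by simp
  then have "int (m * (p - w)) = int (m * (p - Suc w)) + int m" by simp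
  then have "?D - int m = int (m * (p - Suc w)) - int n * ?h" using D by linarith
  then have "(?D - int m) div int n = int (m * (p - Suc w)) div int n - ?h"
    by (simp only: div_shift[OF n_pos])
  moreover have "?D div int n = int (m * (p - w)) div int n - ?h"
    unfolding D by (rule div_shift[OF n_pos])
  ultimately show ?thesis using 1 2 by linarith
qed

lemma sum_zeta_plus_dinv:
  "(\<Sum>p<d * n. int (zeta_at d n m y (p, y ! p))) + int (dinv d n m y) = int (delta d n m)"
proof -
  let ?A = "\<lambda>p w. reach n (rank p + 1 - int m - int n) (rank w)
    - reach n (rank p + 1 - int m - int n) (rank w - int m)"
  let ?B = "\<lambda>p w. reach n (rank p) (rank w) - reach n (rank p) (rank w - int m)"
  have "(\<Sum>p<d * n. int (zeta_at d n m y (p, y ! p))) + int (dinv d n m y)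
      = (\<Sum>p<d * n. (\<Sum>w<p. ?A p w) + (\<Sum>w = Suc p..<d * n. ?B p w))"
    unfolding dinv_columns sum.distrib[symmetric]
    by (intro sum.cong refl zeta_plus_dinv_at) simp
  also have "\<dots> = (\<Sum>p<d * n. \<Sum>w<p. ?A p w + ?B w p)"
    unfolding sum.distrib sum_triangle ..
  also have "\<dots> = (\<Sum>p<d * n. \<Sum>w<p. int (m * (p - w)) div int n - int (m * (p - Suc w)) div int n)"
    by (intro sum.cong refl pair_contribution) simp_all
  also have "\<dots> = (\<Sum>p<d * n. int (m * p) div int n)"
  proof (rule sum.cong[OF refl])
    fix p
    show "(\<Sum>w<p. int (m * (p - w)) div int n - int (m * (p - Suc w)) div int n) = int (m * p) div int n"
      using sum_lessThan_telescope'[of "\<lambda>w. int (m * (p - w)) div int n" p] by (simp only:) simp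
  qed
  also have "\<dots> = int (delta d n m)" by (rule delta_eq[OF d_pos n_pos coprime, symmetric])
  finally show ?thesis .
qed

end

section \<open>The sweep map as a composition\<close>

theorem proposition4p13:
  fixes d n m :: nat
  assumes "d \<ge> 1" and "n \<ge> 1" and "m > n" and "coprime m n"
  shows "(\<forall>y\<in>dyck_paths d n m. zeta d n m y = (G_map d n m \<circ> Psi d n m) y) \<and>
    (\<forall>y\<in>dyck_paths d n m. \<forall>\<Delta> c. \<Delta> = Psi d n m y \<longrightarrow> c = Psi_coords d n m y \<longrightarrow>
       \<Delta> \<in> Adm d n m \<and> corresponds d n m \<Delta> c \<and>
       (\<forall>k<d. \<forall>l<n. G_at d n m c (k * n + l, c ! (k * n + l)) =
          zeta_at d n m y (s_perm d n m y l k * n + l, y ! (s_perm d n m y l k * n + l))) \<and>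
       e_stat d n m \<Delta> = sum_list c \<and> sum_list c = sum_list y \<and>
       dim_stat d n m \<Delta> = sum_list (zeta d n m y) \<and>
       sum_list (zeta d n m y) = co_dinv d n m y)"
proof (intro conjI ballI allI impI)
  fix y assume "y \<in> dyck_paths d n m"
  then interpret dyck d n m y using assms by unfold_locales auto
  show "zeta d n m y = (G_map d n m \<circ> Psi d n m) y" using zeta_eq_G_map by simp
next
  fix y \<Delta> c
  assume y: "y \<in> dyck_paths d n m" and \<Delta>: "\<Delta> = Psi d n m y" and c: "c = Psi_coords d n m y"
  interpret dyck d n m y using assms y by unfold_locales auto
  show "\<Delta> \<in> Adm d n m" unfolding \<Delta> by (rule Psi_Adm)
  show "corresponds d n m \<Delta> c" unfolding \<Delta> c by (rule corresponds_Psi)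
  show "e_stat d n m \<Delta> = sum_list c" unfolding \<Delta> c by (rule e_stat_Psi)
  show "sum_list c = sum_list y" unfolding c by (rule sum_c)
  show "dim_stat d n m \<Delta> = sum_list (zeta d n m y)"
    unfolding \<Delta> dim_stat_Psi sum_zeta by (rule sum_G_eq_sum_zeta)
  show "sum_list (zeta d n m y) = co_dinv d n m y"
    using sum_zeta_plus_dinv by (simp add: co_dinv_def sum_zeta)
  fix k l assume kl: "k < d" "l < n"
  have "Suc k * n \<le> d * n" using kl by (intro mult_le_mono1) simp
  then have "k * n + l < d * n" using kl by simp
  moreover have "sigma (k * n + l) = s_perm d n m y l k * n + l" using kl by (simp add: sigma_eq)
  ultimately show "G_at d n m c (k * n + l, c ! (k * n + l)) =
      zeta_at d n m y (s_perm d n m y l k * n + l, y ! (s_perm d n m y l k * n + l))"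
    unfolding c using G_at_eq_zeta_at by metis
qed

end
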